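(* Let $q\ge 1$ and $[q]=\{1,\dots,q\}$. There exists a randomised algorithm which, given two product distributions $P=P_1\otimes\cdots\otimes P_n$ and $Q=Q_1\otimes\cdots\otimes Q_n$ over $[q]^n$ (each specified by the list of marginal probabilities $P_i(c),Q_i(c)$ for $i\in[n]$, $c\in[q]$) and parameters $\epsilon>0$ and $0<\delta<1$, runs in time $O\!\left(\frac{n^3}{\epsilon^2}\log\frac{1}{\delta}\right)$ and outputs a random value $\widehat d$ such that $$\Pr\left[(1-\epsilon)\,d_{TV}(P,Q)\le \widehat d\le (1+\epsilon)\,d_{TV}(P,Q)\right]\ge 1-\delta.$$
   Context: For distributions $P,Q$ on a finite set $\Omega$, the total variation distance is $d_{TV}(P,Q)=\frac12\sum_{\omega\in\Omega}|P(\omega)-Q(\omega)|$. The running time is measured assuming every arithmetic operation on real numbers (and sampling from an explicitly given distribution on $[q]$) costs $O(1)$ time; the dependence on $q$ is treated as a constant (hidden factor linear in $q$).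
   Formalization: The running time is proved as O(1 + (n^3/ε^2)(1 + log(1/δ))), because the stated bound drops below one step as δ tends to 1 or ε grows and then cannot hold; n ≥ 1 is assumed, and the constant may depend on q. *)

theory Defs
  imports "HOL-Probability.Probability"
begin

text \<open>A probabilistic real-RAM with unit cost per executed instruction.
  Registers hold reals; arithmetic (+,-,*,/), comparisons, integer constants,
  indirect addressing (only with natural-number-valued addresses, no floor),
  and sampling from an explicitly stored distribution on a q-element set
  (stored in q consecutive registers) each cost one step.\<close>

datatype aop = AAdd | ASub | AMul | ADiv

datatype instr =
    LoadConst nat int
  | Arith aop nat nat nat        \<comment> \<open>r_d := r_a op r_b\<close>
  | Load nat nat                 \<comment> \<open>r_d := r_(r_a)\<close>
  | Store nat nat                \<comment> \<open>r_(r_a) := r_v\<close>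
  | JmpLess nat nat nat          \<comment> \<open>if r_a < r_b then goto t\<close>
  | Jmp nat
  | Sample nat nat               \<comment> \<open>r_d := c with probability r_(r_a + c), c < q\<close>

type_synonym state = "nat \<times> (nat \<Rightarrow> real)"

fun aop_eval :: "aop \<Rightarrow> real \<Rightarrow> real \<Rightarrow> real" where
  "aop_eval AAdd x y = x + y"
| "aop_eval ASub x y = x - y"
| "aop_eval AMul x y = x * y"
| "aop_eval ADiv x y = x / y"

definition halted :: "instr list \<Rightarrow> state \<Rightarrow> bool" where
  "halted prog s \<longleftrightarrow> length prog \<le> fst s"

text \<open>One step. Faulty instructions (non-natural address, invalid distribution)
  leave the state unchanged, so the machine never halts.\<close>
definition step :: "nat \<Rightarrow> instr list \<Rightarrow> state \<Rightarrow> state pmf" where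
  "step q prog s = (case s of (pc, m) \<Rightarrow>
     if length prog \<le> pc then return_pmf s else
     (case prog ! pc of
        LoadConst d k \<Rightarrow> return_pmf (Suc pc, m(d := of_int k))
      | Arith f d a b \<Rightarrow> return_pmf (Suc pc, m(d := aop_eval f (m a) (m b)))
      | Load d a \<Rightarrow> (if m a \<in> \<nat> then return_pmf (Suc pc, m(d := m (nat \<lfloor>m a\<rfloor>)))
                    else return_pmf s)
      | Store a v \<Rightarrow> (if m a \<in> \<nat> then return_pmf (Suc pc, m(nat \<lfloor>m a\<rfloor> := m v))
                     else return_pmf s)
      | JmpLess a b t \<Rightarrow> return_pmf (if m a < m b then t else Suc pc, m)
      | Jmp t \<Rightarrow> return_pmf (t, m)
      | Sample d a \<Rightarrow>
          (if m a \<in> \<nat> \<and> (\<forall>c<q. 0 \<le> m (nat \<lfloor>m a\<rfloor> + c))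
              \<and> (\<Sum>c<q. m (nat \<lfloor>m a\<rfloor> + c)) = 1
           then map_pmf (\<lambda>c. (Suc pc, m(d := real c)))
                  (embed_pmf (\<lambda>c. if c < q then m (nat \<lfloor>m a\<rfloor> + c) else 0))
           else return_pmf s)))"

fun run :: "nat \<Rightarrow> instr list \<Rightarrow> nat \<Rightarrow> state \<Rightarrow> state pmf" where
  "run q prog 0 s = return_pmf s"
| "run q prog (Suc k) s = bind_pmf (step q prog s) (run q prog k)"

text \<open>Input encoding: r0 = n, r1 = eps, r2 = delta, then the n*q values P i c
  (i < n, c < q) in row-major order, then the n*q values Q i c; all other
  registers 0. Coordinates and symbols are 0-based (i < n, c < q).\<close>
definition init_mem :: "nat \<Rightarrow> nat \<Rightarrow> real \<Rightarrow> real \<Rightarrow>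
    (nat \<Rightarrow> nat \<Rightarrow> real) \<Rightarrow> (nat \<Rightarrow> nat \<Rightarrow> real) \<Rightarrow> nat \<Rightarrow> real" where
  "init_mem q n eps delta P Q j =
     (if j = 0 then real n else if j = 1 then eps else if j = 2 then delta
      else if j < 3 + n * q then P ((j - 3) div q) ((j - 3) mod q)
      else if j < 3 + 2 * n * q then Q ((j - 3 - n * q) div q) ((j - 3 - n * q) mod q)
      else 0)"

definition dtv_prod :: "nat \<Rightarrow> nat \<Rightarrow> (nat \<Rightarrow> nat \<Rightarrow> real) \<Rightarrow> (nat \<Rightarrow> nat \<Rightarrow> real) \<Rightarrow> real" where
  "dtv_prod q n P Q = (1/2) * (\<Sum>x\<in>PiE {..<n} (\<lambda>_. {..<q}).
      \<bar>(\<Prod>i<n. P i (x i)) - (\<Prod>i<n. Q i (x i))\<bar>)"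

definition marginals :: "nat \<Rightarrow> nat \<Rightarrow> (nat \<Rightarrow> nat \<Rightarrow> real) \<Rightarrow> bool" where
  "marginals q n P \<longleftrightarrow> (\<forall>i<n. (\<forall>c<q. 0 \<le> P i c) \<and> (\<Sum>c<q. P i c) = 1)"

end

theory Submission
  imports Defs
begin

text \<open>Write \<open>m\<^sub>i = min P\<^sub>i Q\<^sub>i\<close>, let \<open>G\<^sub>i\<close> be the total mass of \<open>m\<^sub>1 \<otimes> \<dots> \<otimes> m\<^sub>i\<close> and
  \<open>Z = 1 - G\<^sub>n\<close>, the probability that the coordinatewise maximal coupling of \<open>P\<close> and \<open>Q\<close> fails.
  Then \<open>Z / n \<le> d\<^sub>T\<^sub>V \<le> Z\<close>, and \<open>d\<^sub>T\<^sub>V\<close> is \<open>Z\<close> times the mean of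
  \<open>f(x) = max 0 (P(x) - Q(x)) / (P(x) - \<Prod>m\<^sub>i(x\<^sub>i)) \<in> [0, 1]\<close> under the distribution
  \<open>(P - \<Otimes>m\<^sub>i) / Z\<close>. The latter can be sampled coordinate by coordinate: with \<open>A\<close> and \<open>B\<close> the
  products of the \<open>P\<close>- and \<open>m\<close>-values of the symbols chosen so far (from coordinate \<open>n\<close> downwards)
  the next symbol \<open>c\<close> has probability \<open>(A P\<^sub>i(c) - B m\<^sub>i(c) G\<^sub>i\<^sub>-\<^sub>1) / (A - B G\<^sub>i)\<close>. As \<open>f\<close> has
  mean at least \<open>1 / n\<close>, a multiplicative Chernoff bound shows that \<open>O(n log(1/\<delta>) / \<epsilon>\<^sup>2)\<close>
  samples of cost \<open>O(n)\<close> suffice. For \<open>\<epsilon> \<ge> 1\<close> the answer \<open>0\<close> is correct, and there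
  need not be enough time to read the input.\<close>

subsection \<open>A multiplicative Chernoff bound\<close>

text \<open>The kernel \<open>F\<close> receives the number of steps still to follow, so indices run
  downwards. One scheme thus covers sums of independent draws, coordinates chosen from the last to
  the first, and the loop rule of the program logic.\<close>

primrec iter_pmf :: "(nat \<Rightarrow> 'a \<Rightarrow> 'a pmf) \<Rightarrow> nat \<Rightarrow> 'a \<Rightarrow> 'a pmf" where
  "iter_pmf F 0 a = return_pmf a"
| "iter_pmf F (Suc i) a = bind_pmf (F i a) (iter_pmf F i)"

lemma finite_set_iter_pmf:
  assumes "\<And>i a. finite (set_pmf (F i a))"
  shows "finite (set_pmf (iter_pmf F N a))"
  by (induction N arbitrary: a) (auto simp: assms)

lemma exp_le_quadratic:
  assumes "\<bar>x\<bar> \<le> (1::real)"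
  shows "exp x \<le> 1 + x + x\<^sup>2"
proof (cases "0 \<le> x")
  case True
  then show ?thesis using exp_bound assms by auto
next
  case False
  define y where "y = - x"
  have y: "0 < y" "y \<le> 1" using False assms by (auto simp: y_def)
  have "1 + y + y\<^sup>2 / 2 \<le> exp y" using y by (intro exp_lower_Taylor_quadratic) auto
  \<comment> \<open>The Taylor lower bound for \<open>exp y\<close> times the claimed upper bound
    for \<open>exp (- y)\<close> expands to 1 plus nonnegative terms.\<close>
  moreover have "1 \<le> (1 + y + y\<^sup>2 / 2) * (1 - y + y\<^sup>2)"
  proof -
    have "(1 + y + y\<^sup>2 / 2) * (1 - y + y\<^sup>2) = 1 + y\<^sup>2 / 2 + y^3 / 2 + y^4 / 2"
      by (simp add: field_simps power2_eq_square power3_eq_cube power4_eq_xxxx)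
    then show ?thesis using y by simp
  qed
  moreover have p: "0 < 1 - y + y\<^sup>2"
    using y by (smt (verit) zero_less_power)
  ultimately have "1 \<le> exp y * (1 - y + y\<^sup>2)"
    by (smt (verit) mult_right_mono)
  then have "exp (- y) \<le> 1 - y + y\<^sup>2"
    by (simp add: exp_minus field_simps)
  then show ?thesis by (simp add: y_def)
qed

text \<open>By independence the moment generating function of the sum is a power. Finite support
  reduces the expectations to finite sums.\<close>

lemma exp_moment_iter_pmf:
  assumes fin: "finite (set_pmf X)"
  shows "measure_pmf.expectation (iter_pmf (\<lambda>_ s. map_pmf (\<lambda>x. s + x) X) N a) (\<lambda>s. exp (l * s))
       = exp (l * a) * (measure_pmf.expectation X (\<lambda>x. exp (l * x :: real))) ^ N"
proof (induction N arbitrary: a)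
  case 0
  then show ?case by simp
next
  case (Suc N)
  let ?F = "\<lambda>(_::nat) s. map_pmf (\<lambda>x. s + x) X"
  have "iter_pmf ?F (Suc N) a = bind_pmf X (\<lambda>x. iter_pmf ?F N (a + x))"
    by (simp add: bind_map_pmf)
  then have "measure_pmf.expectation (iter_pmf ?F (Suc N) a) (\<lambda>s. exp (l * s))
      = (\<Sum>x\<in>set_pmf X. pmf X x * (exp (l * (a + x)) * (measure_pmf.expectation X (\<lambda>x. exp (l * x))) ^ N))"
    by (simp only:, subst pmf_expectation_bind[where A="set_pmf X"])
       (auto simp: fin Suc finite_set_iter_pmf)
  also have "\<dots> = exp (l * a) * (measure_pmf.expectation X (\<lambda>x. exp (l * x))) ^ N
       * (\<Sum>x\<in>set_pmf X. pmf X x * exp (l * x))"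
    by (simp add: sum_distrib_left algebra_simps exp_add)
  also have "(\<Sum>x\<in>set_pmf X. pmf X x * exp (l * x)) = measure_pmf.expectation X (\<lambda>x. exp (l * x))"
    by (subst integral_measure_pmf[where A="set_pmf X"]) (auto simp: fin)
  finally show ?case by simp
qed

text \<open>On \<open>[0, 1]\<close> the square of \<open>x\<close> is at most \<open>x\<close>, so
  the quadratic bound on \<open>exp\<close> becomes linear in \<open>x\<close> and only the mean
  enters.\<close>

lemma exp_moment_le:
  assumes fin: "finite (set_pmf X)" and X: "set_pmf X \<subseteq> {0..1}" and l: "\<bar>l\<bar> \<le> 1"
  shows "measure_pmf.expectation X (\<lambda>x. exp (l * x :: real))
     \<le> exp ((l + l\<^sup>2) * measure_pmf.expectation X (\<lambda>x. x))"
proof -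
  have "measure_pmf.expectation X (\<lambda>x. exp (l * x))
      \<le> measure_pmf.expectation X (\<lambda>x. 1 + (l + l\<^sup>2) * x)"
  proof (intro integral_mono_AE integrable_measure_pmf_finite fin AE_pmfI)
    fix x assume "x \<in> set_pmf X"
    then have x: "0 \<le> x" "x \<le> 1" using X by auto
    have "\<bar>l * x\<bar> \<le> 1" using x l by (simp add: abs_mult mult_le_one)
    from exp_le_quadratic[OF this] have "exp (l * x) \<le> 1 + l * x + l\<^sup>2 * (x * x)"
      by (simp add: power2_eq_square ac_simps)
    also have "l\<^sup>2 * (x * x) \<le> l\<^sup>2 * x"
      using x by (intro mult_left_mono) (auto simp: mult_left_le)
    finally show "exp (l * x) \<le> 1 + (l + l\<^sup>2) * x" by (simp add: algebra_simps)
  qed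
  also have "\<dots> = 1 + (l + l\<^sup>2) * measure_pmf.expectation X (\<lambda>x. x)"
    by (subst Bochner_Integration.integral_add)
       (auto intro!: integrable_measure_pmf_finite fin)
  also have "\<dots> \<le> exp ((l + l\<^sup>2) * measure_pmf.expectation X (\<lambda>x. x))"
    by (rule exp_ge_add_one_self)
  finally show ?thesis .
qed

text \<open>Markov's inequality for \<open>exp (l * s)\<close>. The sign of \<open>l\<close> is left
  open, so that both tails are covered.\<close>

lemma chernoff_iter_pmf_tail:
  fixes X :: "real pmf"
  assumes fin: "finite (set_pmf X)" and X: "set_pmf X \<subseteq> {0..1}" and l: "\<bar>l\<bar> \<le> 1"
  defines "mu \<equiv> measure_pmf.expectation X (\<lambda>x. x)"
  shows "measure_pmf.prob (iter_pmf (\<lambda>_ s. map_pmf (\<lambda>x. s + x) X) N 0)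
     {s. t \<le> l * s} \<le> exp ((l + l\<^sup>2) * (real N * mu) - t)"
proof -
  let ?S = "iter_pmf (\<lambda>_ s. map_pmf (\<lambda>x. s + x) X) N 0"
  have "measure_pmf.prob ?S {s. t \<le> l * s} = measure_pmf.prob ?S {s\<in>space ?S. exp t \<le> exp (l * s)}"
    by simp
  also have "\<dots> \<le> measure_pmf.expectation ?S (\<lambda>s. exp (l * s)) / exp t"
    by (rule integral_Markov_inequality_measure)
       (auto intro!: integrable_measure_pmf_finite finite_set_iter_pmf fin)
  also have "\<dots> = (measure_pmf.expectation X (\<lambda>x. exp (l * x))) ^ N / exp t"
    by (simp add: exp_moment_iter_pmf fin)
  also have "\<dots> \<le> exp ((l + l\<^sup>2) * mu) ^ N / exp t"
    unfolding mu_def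
    by (intro divide_right_mono power_mono exp_moment_le fin X l Bochner_Integration.integral_nonneg) auto
  also have "\<dots> = exp ((l + l\<^sup>2) * (real N * mu) - t)"
    by (simp add: exp_diff exp_of_nat_mult[symmetric] algebra_simps)
  finally show ?thesis .
qed

lemma chernoff_iter_pmf:
  fixes X :: "real pmf"
  assumes fin: "finite (set_pmf X)" and X: "set_pmf X \<subseteq> {0..1}" and e: "0 < e" "e \<le> 1"
  defines "mu \<equiv> measure_pmf.expectation X (\<lambda>x. x)"
  shows "measure_pmf.prob (iter_pmf (\<lambda>_ s. map_pmf (\<lambda>x. s + x) X) N 0)
     {s. (1 - e) * (real N * mu) \<le> s \<and> s \<le> (1 + e) * (real N * mu)}
     \<ge> 1 - 2 * exp (- (real N * mu * e\<^sup>2 / 4))"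
proof -
  let ?S = "iter_pmf (\<lambda>_ s. map_pmf (\<lambda>x. s + x) X) N 0"
  let ?G = "{s. (1 - e) * (real N * mu) \<le> s \<and> s \<le> (1 + e) * (real N * mu)}"
  \<comment> \<open>The choices \<open>l = e/2\<close> and \<open>l = -(e/2)\<close> make both tail
    exponents equal to \<open>-(N * mu * e^2 / 4)\<close>.\<close>
  let ?U = "{s. (e/2) * ((1 + e) * (real N * mu)) \<le> (e/2) * s}"
  let ?L = "{s. (-(e/2)) * ((1 - e) * (real N * mu)) \<le> (-(e/2)) * s}"
  have "- ?G \<subseteq> ?U \<union> ?L" using e by auto
  then have "measure_pmf.prob ?S (- ?G) \<le> measure_pmf.prob ?S (?U \<union> ?L)"
    by (intro measure_pmf.finite_measure_mono) auto
  also have "\<dots> \<le> measure_pmf.prob ?S ?U + measure_pmf.prob ?S ?L"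
    by (intro measure_Un_le) auto
  also have "measure_pmf.prob ?S ?U
      \<le> exp ((e/2 + (e/2)\<^sup>2) * (real N * mu) - (e/2) * ((1 + e) * (real N * mu)))"
    unfolding mu_def using e by (intro chernoff_iter_pmf_tail fin X) auto
  also have "(e/2 + (e/2)\<^sup>2) * (real N * mu) - (e/2) * ((1 + e) * (real N * mu))
      = - (real N * mu * e\<^sup>2 / 4)"
    by (simp add: field_simps power2_eq_square)
  also have "measure_pmf.prob ?S ?L
      \<le> exp ((-(e/2) + (-(e/2))\<^sup>2) * (real N * mu) - (-(e/2)) * ((1 - e) * (real N * mu)))"
    unfolding mu_def using e by (intro chernoff_iter_pmf_tail fin X) auto
  also have "(-(e/2) + (-(e/2))\<^sup>2) * (real N * mu) - (-(e/2)) * ((1 - e) * (real N * mu))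
      = - (real N * mu * e\<^sup>2 / 4)"
    by (simp add: field_simps power2_eq_square)
  finally have "measure_pmf.prob ?S (- ?G) \<le> 2 * exp (- (real N * mu * e\<^sup>2 / 4))" by simp
  moreover have "measure_pmf.prob ?S (- ?G) = 1 - measure_pmf.prob ?S ?G"
    using measure_pmf.prob_compl[of ?G ?S] by (simp add: Compl_eq_Diff_UNIV)
  ultimately show ?thesis by simp
qed

subsection \<open>The estimator\<close>

definition min_marg :: "(nat \<Rightarrow> nat \<Rightarrow> real) \<Rightarrow> (nat \<Rightarrow> nat \<Rightarrow> real) \<Rightarrow> nat \<Rightarrow> nat \<Rightarrow> real" where
  "min_marg P Q i c = min (P i c) (Q i c)"

definition overlap :: "nat \<Rightarrow> (nat \<Rightarrow> nat \<Rightarrow> real) \<Rightarrow> (nat \<Rightarrow> nat \<Rightarrow> real) \<Rightarrow> nat \<Rightarrow> real" where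
  "overlap q P Q i = (\<Prod>j<i. \<Sum>c<q. min_marg P Q j c)"

text \<open>A conditional probability. Subtract \<open>B\<close> times the product of the minima
  from \<open>A\<close> times the product of the \<open>P\<close>-values, over coordinates
  \<open>0\<close> to \<open>i\<close>: the denominator is the total mass of this difference, the
  numerator its mass on the points with symbol \<open>c\<close> at coordinate
  \<open>i\<close>.\<close>

definition weight :: "nat \<Rightarrow> (nat \<Rightarrow> nat \<Rightarrow> real) \<Rightarrow> (nat \<Rightarrow> nat \<Rightarrow> real) \<Rightarrow> nat \<Rightarrow> real \<Rightarrow> real \<Rightarrow> nat \<Rightarrow> real" where
  "weight q P Q i A B c = (A * P i c - min_marg P Q i c * (B * overlap q P Q i))
     / (A - B * overlap q P Q (Suc i))"

text \<open>Written exactly as the machine's \<open>Sample\<close> builds its distribution, so that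
  the two agree literally.\<close>

definition symbol_pmf :: "nat \<Rightarrow> (nat \<Rightarrow> nat \<Rightarrow> real) \<Rightarrow> (nat \<Rightarrow> nat \<Rightarrow> real) \<Rightarrow> nat \<Rightarrow> real \<Rightarrow> real \<Rightarrow> nat pmf" where
  "symbol_pmf q P Q i A B = embed_pmf (\<lambda>c. if c < q then weight q P Q i A B c else 0)"

text \<open>In a state \<open>(A, B, D)\<close> the components are the products over the coordinates chosen so far of
  the \<open>P\<close>-values, of the minima, and of the \<open>Q\<close>-values. Coordinates below the current
  index \<open>i\<close> are still open.\<close>

definition extend_pmf :: "nat \<Rightarrow> (nat \<Rightarrow> nat \<Rightarrow> real) \<Rightarrow> (nat \<Rightarrow> nat \<Rightarrow> real) \<Rightarrow> nat
    \<Rightarrow> real \<times> real \<times> real \<Rightarrow> (real \<times> real \<times> real) pmf" where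
  "extend_pmf q P Q i = (\<lambda>(A, B, D).
     map_pmf (\<lambda>c. (A * P i c, B * min_marg P Q i c, D * Q i c)) (symbol_pmf q P Q i A B))"

fun ratio :: "real \<times> real \<times> real \<Rightarrow> real" where
  "ratio (A, B, D) = max 0 (A - D) / (A - B)"

text \<open>The strict conjunct says that the completions of the current choice carry positive mass.
  At index \<open>Suc i\<close> it keeps the denominator of \<open>weight\<close> for coordinate
  \<open>i\<close> positive, at index \<open>0\<close> that of \<open>ratio\<close>.\<close>

fun consistent :: "nat \<Rightarrow> (nat \<Rightarrow> nat \<Rightarrow> real) \<Rightarrow> (nat \<Rightarrow> nat \<Rightarrow> real) \<Rightarrow> nat \<Rightarrow> real \<times> real \<times> real \<Rightarrow> bool" where
  "consistent q P Q i (A, B, D) \<longleftrightarrow> 0 \<le> B \<and> B \<le> A \<and> B \<le> D \<and> B * overlap q P Q i < A"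

text \<open>The total variation distance, as a sum of positive parts, generalised to a partly chosen
  point: \<open>A\<close> and \<open>D\<close> are the factors already fixed. This form admits a
  recursion on the number of open coordinates.\<close>

definition excess :: "nat \<Rightarrow> (nat \<Rightarrow> nat \<Rightarrow> real) \<Rightarrow> (nat \<Rightarrow> nat \<Rightarrow> real) \<Rightarrow> nat \<Rightarrow> real \<Rightarrow> real \<Rightarrow> real" where
  "excess q P Q i A D = (\<Sum>x\<in>PiE {..<i} (\<lambda>_. {..<q}).
     max 0 (A * (\<Prod>j<i. P j (x j)) - D * (\<Prod>j<i. Q j (x j))))"

lemma sum_PiE_lessThan_Suc:
  "(\<Sum>x\<in>PiE {..<Suc i} (\<lambda>_. {..<q}). g x)
     = (\<Sum>c<q. \<Sum>x\<in>PiE {..<i} (\<lambda>_. {..<q}). g (x(i := c)))"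
proof -
  have "(\<Sum>x\<in>PiE {..<Suc i} (\<lambda>_. {..<q}). g x)
      = (\<Sum>x\<in>(\<lambda>(y, h). h(i := y)) ` ({..<q} \<times> PiE {..<i} (\<lambda>_. {..<q})). g x)"
    by (simp add: lessThan_Suc PiE_insert_eq)
  also have "\<dots> = (\<Sum>(c, x)\<in>{..<q} \<times> PiE {..<i} (\<lambda>_. {..<q}). g (x(i := c)))"
    by (subst sum.reindex)
       (use inj_combinator[of i "{..<i}" "\<lambda>_. {..<q}"] in \<open>auto simp: case_prod_unfold\<close>)
  also have "\<dots> = (\<Sum>c<q. \<Sum>x\<in>PiE {..<i} (\<lambda>_. {..<q}). g (x(i := c)))"
    by (simp add: sum.cartesian_product)
  finally show ?thesis .
qed

lemma excess_Suc:
  "excess q P Q (Suc i) A D = (\<Sum>c<q. excess q P Q i (A * P i c) (D * Q i c))"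
proof -
  have *: "(\<Prod>j<i. R j ((x(i := c)) j)) = (\<Prod>j<i. R j (x j))" for R :: "nat \<Rightarrow> nat \<Rightarrow> real" and x c
    by (intro prod.cong) auto
  show ?thesis
    unfolding excess_def sum_PiE_lessThan_Suc prod.lessThan_Suc * by (simp add: mult_ac)
qed

lemma sum_prod_PiE_lessThan:
  fixes f :: "nat \<Rightarrow> nat \<Rightarrow> real"
  shows "(\<Sum>x\<in>PiE {..<n} (\<lambda>_. {..<q}). \<Prod>i<n. f i (x i)) = (\<Prod>i<n. \<Sum>c<q. f i c)"
  using prod_sum_PiE[of "{..<n}" "\<lambda>_. {..<q}" f] by simp

text \<open>The Weierstrass product inequality; here it acts as a union bound over the coordinates
  at which the coupling can fail.\<close>

lemma prod_ge_1_minus_sum: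
  fixes s :: "'a \<Rightarrow> real"
  assumes "finite I" "\<And>i. i \<in> I \<Longrightarrow> 0 \<le> s i \<and> s i \<le> 1"
  shows "1 - (\<Sum>i\<in>I. 1 - s i) \<le> (\<Prod>i\<in>I. s i)"
  using assms
proof (induction I rule: finite_induct)
  case (insert x F)
  have "0 \<le> (\<Prod>i\<in>F. s i)" "(\<Prod>i\<in>F. s i) \<le> 1"
    using insert by (auto intro!: prod_nonneg prod_le_1)
  then have "(1 - s x) * (\<Prod>i\<in>F. s i) \<le> (1 - s x) * 1"
    using insert by (intro mult_left_mono) auto
  then show ?case using insert by (simp add: algebra_simps)
qed simp

section \<open>The conditional distribution of the next coordinate\<close>

locale marginal_pair =
  fixes q n :: nat and P Q :: "nat \<Rightarrow> nat \<Rightarrow> real"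
  assumes P: "marginals q n P" and Q: "marginals q n Q"
begin

abbreviation "mn \<equiv> min_marg P Q"
abbreviation "G \<equiv> overlap q P Q"

lemma P_nonneg: "i < n \<Longrightarrow> c < q \<Longrightarrow> 0 \<le> P i c"
  and P_sum: "i < n \<Longrightarrow> (\<Sum>c<q. P i c) = 1"
  and Q_nonneg: "i < n \<Longrightarrow> c < q \<Longrightarrow> 0 \<le> Q i c"
  and Q_sum: "i < n \<Longrightarrow> (\<Sum>c<q. Q i c) = 1"
  using P Q by (auto simp: marginals_def)

lemma mn_nonneg: "i < n \<Longrightarrow> c < q \<Longrightarrow> 0 \<le> mn i c"
  and mn_le_P: "mn i c \<le> P i c" and mn_le_Q: "mn i c \<le> Q i c"
  by (auto simp: min_marg_def P_nonneg Q_nonneg)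

lemma mn_sum: "i < n \<Longrightarrow> 0 \<le> (\<Sum>c<q. mn i c) \<and> (\<Sum>c<q. mn i c) \<le> 1"
  using sum_mono[of "{..<q}" "mn i" "P i"] mn_le_P
  by (auto intro!: sum_nonneg mn_nonneg simp: P_sum)

lemma overlap_bounds: "i \<le> n \<Longrightarrow> 0 \<le> G i \<and> G i \<le> 1"
  unfolding overlap_def using mn_sum by (auto intro!: prod_nonneg prod_le_1)

lemma overlap_Suc: "G (Suc i) = G i * (\<Sum>c<q. mn i c)"
  by (simp add: overlap_def)

lemma weight_nonneg:
  assumes i: "i < n" and c: "c < q" and con: "consistent q P Q (Suc i) (A, B, D)"
  shows "0 \<le> weight q P Q i A B c"
proof -
  have "mn i c * (B * G i) = (B * mn i c) * G i" by simp
  also have "\<dots> \<le> (B * mn i c) * 1"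
    using con i c overlap_bounds[of i] by (intro mult_left_mono mult_nonneg_nonneg mn_nonneg) auto
  also have "\<dots> \<le> A * P i c"
    using con i c by (auto intro!: mult_mono mn_le_P mn_nonneg)
  finally show ?thesis using con by (auto simp: weight_def)
qed

text \<open>By \<open>overlap_Suc\<close> the numerators add up to the denominator, which is
  positive by consistency.\<close>

lemma sum_weight:
  assumes "i < n" and "consistent q P Q (Suc i) (A, B, D)"
  shows "(\<Sum>c<q. weight q P Q i A B c) = 1"
proof -
  have "(\<Sum>c<q. weight q P Q i A B c)
      = ((\<Sum>c<q. A * P i c) - (\<Sum>c<q. mn i c * (B * G i))) / (A - B * G (Suc i))"
    by (simp add: weight_def sum_subtractf sum_divide_distrib[symmetric])
  also have "(\<Sum>c<q. A * P i c) = A"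
    by (simp add: sum_distrib_left[symmetric] P_sum assms)
  also have "(\<Sum>c<q. mn i c * (B * G i)) = B * G (Suc i)"
    by (simp add: sum_distrib_right[symmetric] overlap_Suc)
  finally show ?thesis using assms by auto
qed

lemma pmf_symbol_pmf:
  assumes i: "i < n" and con: "consistent q P Q (Suc i) (A, B, D)"
  shows "pmf (symbol_pmf q P Q i A B) c = (if c < q then weight q P Q i A B c else 0)"
  unfolding symbol_pmf_def
proof (rule pmf_embed_pmf)
  let ?f = "\<lambda>c. if c < q then weight q P Q i A B c else 0"
  show nn: "0 \<le> ?f c" for c using weight_nonneg[OF i _ con] by simp
  have "(\<integral>\<^sup>+c. ennreal (?f c) \<partial>count_space UNIV) = (\<Sum>c<q. ennreal (?f c))"
    by (rule nn_integral_count_space'[where A="{..<q}"]) auto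
  also have "\<dots> = ennreal (\<Sum>c<q. ?f c)" using nn by (intro sum_ennreal)
  also have "(\<Sum>c<q. ?f c) = 1" using sum_weight[OF i con] by simp
  finally show "(\<integral>\<^sup>+c. ennreal (?f c) \<partial>count_space UNIV) = 1" by simp
qed

lemma set_symbol_pmf:
  assumes "i < n" "consistent q P Q (Suc i) (A, B, D)"
  shows "set_pmf (symbol_pmf q P Q i A B) \<subseteq> {..<q}"
  by (auto simp: set_pmf_eq pmf_symbol_pmf[OF assms] split: if_splits)

text \<open>The strict conjunct of the new state is the positivity of the numerator of the
  weight.\<close>

lemma consistent_extend:
  assumes i: "i < n" and con: "consistent q P Q (Suc i) (A, B, D)"
    and c: "c < q" and w: "weight q P Q i A B c \<noteq> 0"
  shows "consistent q P Q i (A * P i c, B * mn i c, D * Q i c)"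
proof -
  have "0 < weight q P Q i A B c" using weight_nonneg[OF i c con] w by simp
  then have "mn i c * (B * G i) < A * P i c"
    using con by (auto simp: weight_def zero_less_divide_iff)
  then show ?thesis using con i c
    by (auto simp: ac_simps intro!: mult_nonneg_nonneg mult_mono mn_nonneg mn_le_P mn_le_Q)
qed

lemma finite_set_extend:
  assumes "i < n" "consistent q P Q (Suc i) s"
  shows "finite (set_pmf (extend_pmf q P Q i s))"
proof -
  obtain A B D where s: "s = (A, B, D)" by (cases s)
  have "finite (set_pmf (symbol_pmf q P Q i A B))"
    using set_symbol_pmf[of i A B D] assms by (auto simp: s intro: finite_subset)
  then show ?thesis by (simp add: extend_pmf_def s)
qed

lemma set_extend_consistent:
  assumes "i < n" "consistent q P Q (Suc i) s" "s' \<in> set_pmf (extend_pmf q P Q i s)"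
  shows "consistent q P Q i s'"
proof -
  obtain A B D where s: "s = (A, B, D)" by (cases s)
  from assms obtain c where c: "c \<in> set_pmf (symbol_pmf q P Q i A B)"
    and s': "s' = (A * P i c, B * mn i c, D * Q i c)" by (auto simp: extend_pmf_def s)
  have "c < q" "weight q P Q i A B c \<noteq> 0"
    using c assms by (auto simp: set_pmf_eq pmf_symbol_pmf s split: if_splits)
  then show ?thesis using assms consistent_extend by (simp add: s s')
qed

lemma finite_set_iter_extend:
  "i \<le> n \<Longrightarrow> consistent q P Q i s \<Longrightarrow> finite (set_pmf (iter_pmf (extend_pmf q P Q) i s))"
  by (induction i arbitrary: s) (auto simp: finite_set_extend set_extend_consistent)

lemma set_iter_extend_consistent:
  "i \<le> n \<Longrightarrow> consistent q P Q i s \<Longrightarrow> s' \<in> set_pmf (iter_pmf (extend_pmf q P Q) i s)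
    \<Longrightarrow> consistent q P Q 0 s'"
proof (induction i arbitrary: s)
  case (Suc i)
  then obtain t where t: "t \<in> set_pmf (extend_pmf q P Q i s)"
    "s' \<in> set_pmf (iter_pmf (extend_pmf q P Q) i t)" by auto
  with Suc show ?case using set_extend_consistent[of i s t] by simp
qed simp

section \<open>The mean of the estimator\<close>

text \<open>Pointwise, \<open>B\<close> times the product of the minima is below both weighted
  products. The bound shows that a symbol of weight 0 carries no excess, and that the distance
  vanishes once the overlap reaches 1.\<close>

lemma excess_le:
  assumes "i \<le> n" "0 \<le> B" "B \<le> A" "B \<le> D"
  shows "excess q P Q i A D \<le> A - B * G i"
proof -
  have "excess q P Q i A D \<le> (\<Sum>x\<in>PiE {..<i} (\<lambda>_. {..<q}).
      A * (\<Prod>j<i. P j (x j)) - B * (\<Prod>j<i. mn j (x j)))"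
    unfolding excess_def
  proof (rule sum_mono)
    fix x assume x: "x \<in> PiE {..<i} (\<lambda>_. {..<q})"
    have xj: "j < n" "x j < q" if "j < i" for j using x that assms by (auto simp: PiE_iff)
    have 0: "0 \<le> (\<Prod>j<i. mn j (x j))" using xj by (intro prod_nonneg) (auto simp: mn_nonneg)
    have 1: "(\<Prod>j<i. mn j (x j)) \<le> (\<Prod>j<i. P j (x j))"
      using xj by (intro prod_mono) (auto simp: mn_nonneg mn_le_P)
    have 2: "(\<Prod>j<i. mn j (x j)) \<le> (\<Prod>j<i. Q j (x j))"
      using xj by (intro prod_mono) (auto simp: mn_nonneg mn_le_Q)
    have "B * (\<Prod>j<i. mn j (x j)) \<le> A * (\<Prod>j<i. P j (x j))"
      using assms 0 1 by (intro mult_mono) auto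
    moreover have "B * (\<Prod>j<i. mn j (x j)) \<le> D * (\<Prod>j<i. Q j (x j))"
      using assms 0 2 by (intro mult_mono) auto
    ultimately show "max 0 (A * (\<Prod>j<i. P j (x j)) - D * (\<Prod>j<i. Q j (x j)))
        \<le> A * (\<Prod>j<i. P j (x j)) - B * (\<Prod>j<i. mn j (x j))" by simp
  qed
  also have "\<dots> = A * (\<Prod>j<i. \<Sum>c<q. P j c) - B * G i"
    by (simp add: sum_subtractf sum_distrib_left[symmetric] sum_prod_PiE_lessThan overlap_def)
  also have "(\<Prod>j<i. \<Sum>c<q. P j c) = 1" using assms by (auto simp: P_sum)
  finally show ?thesis by simp
qed

lemma excess_nonneg: "0 \<le> excess q P Q i A D"
  by (simp add: excess_def sum_nonneg)

text \<open>Multiplying by the remaining mass cancels the denominators of the weights, so one step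
  of the chain turns into the plain sum over symbols of \<open>excess_Suc\<close>. From the state
  \<open>(1, 1, 1)\<close> with \<open>i = n\<close> this says that the failure probability times
  the mean is the distance.\<close>

lemma expectation_ratio:
  assumes "i \<le> n" "consistent q P Q i (A, B, D)"
  shows "(A - B * G i) * measure_pmf.expectation (iter_pmf (extend_pmf q P Q) i (A, B, D)) ratio
    = excess q P Q i A D"
  using assms
proof (induction i arbitrary: A B D)
  case 0
  then show ?case by (auto simp: excess_def overlap_def)
next
  case (Suc i)
  then have i: "i < n" and con: "consistent q P Q (Suc i) (A, B, D)" by auto
  let ?E = "\<lambda>c. measure_pmf.expectation
     (iter_pmf (extend_pmf q P Q) i (A * P i c, B * mn i c, D * Q i c)) ratio"
  let ?S = "symbol_pmf q P Q i A B"
  have supp: "c < q \<and> weight q P Q i A B c \<noteq> 0" if "c \<in> set_pmf ?S" for c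
    using that by (auto simp: set_pmf_eq pmf_symbol_pmf[OF i con] split: if_splits)
  have finS: "finite (set_pmf ?S)" using set_symbol_pmf[OF i con] by (rule finite_subset) simp
  have "iter_pmf (extend_pmf q P Q) (Suc i) (A, B, D)
      = bind_pmf ?S (\<lambda>c. iter_pmf (extend_pmf q P Q) i (A * P i c, B * mn i c, D * Q i c))"
    by (simp add: extend_pmf_def bind_map_pmf)
  then have "measure_pmf.expectation (iter_pmf (extend_pmf q P Q) (Suc i) (A, B, D)) ratio
      = (\<Sum>c\<in>set_pmf ?S. pmf ?S c * ?E c)"
    using i supp
    by (simp only:, subst pmf_expectation_bind[where A="set_pmf ?S"])
       (auto simp: finS intro!: finite_set_iter_extend consistent_extend[OF i con])
  also have "\<dots> = (\<Sum>c<q. weight q P Q i A B c * ?E c)"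
    by (intro sum.mono_neutral_cong_left)
       (use set_symbol_pmf[OF i con] in \<open>auto simp: pmf_symbol_pmf[OF i con] set_pmf_eq\<close>)
  finally have "(A - B * G (Suc i)) * measure_pmf.expectation
        (iter_pmf (extend_pmf q P Q) (Suc i) (A, B, D)) ratio
      = (\<Sum>c<q. (A - B * G (Suc i)) * (weight q P Q i A B c * ?E c))"
    by (simp add: sum_distrib_left)
  also have "\<dots> = (\<Sum>c<q. excess q P Q i (A * P i c) (D * Q i c))"
  proof (rule sum.cong)
    fix c assume "c \<in> {..<q}"
    then have c: "c < q" by simp
    have w: "(A - B * G (Suc i)) * weight q P Q i A B c = A * P i c - B * mn i c * G i"
      using con by (auto simp: weight_def field_simps)
    show "(A - B * G (Suc i)) * (weight q P Q i A B c * ?E c)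
        = excess q P Q i (A * P i c) (D * Q i c)"
    proof (cases "weight q P Q i A B c = 0")
      case True
      then have "A * P i c - B * mn i c * G i = 0" using w by simp
      moreover have "excess q P Q i (A * P i c) (D * Q i c) \<le> A * P i c - B * mn i c * G i"
        using i c con by (intro excess_le)
          (auto intro!: mult_nonneg_nonneg mult_mono mn_nonneg mn_le_P mn_le_Q)
      ultimately show ?thesis using True excess_nonneg[of i "A * P i c" "D * Q i c"] by simp
    next
      case False
      have "(A * P i c - B * mn i c * G i) * ?E c = excess q P Q i (A * P i c) (D * Q i c)"
        using i by (intro Suc.IH consistent_extend[OF i con c False]) auto
      then show ?thesis using w by (simp add: mult.assoc[symmetric])
    qed
  qed simp
  also have "\<dots> = excess q P Q (Suc i) A D" by (simp add: excess_Suc)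
  finally show ?case .
qed

lemma ratio_range:
  assumes "consistent q P Q 0 s"
  shows "ratio s \<in> {0..1}"
  using assms by (cases s) (auto simp: overlap_def divide_le_eq)

section \<open>Total variation distance against the failure probability of the coupling\<close>

lemma dtv_eq_excess: "dtv_prod q n P Q = excess q P Q n 1 1"
proof -
  \<comment> \<open>Both products have mass 1, so the positive part of their difference carries half
    of the absolute sum.\<close>
  have "(\<Sum>x\<in>PiE {..<n} (\<lambda>_. {..<q}). (\<Prod>i<n. P i (x i)) - (\<Prod>i<n. Q i (x i))) = 0"
    by (simp add: sum_subtractf sum_prod_PiE_lessThan P_sum Q_sum)
  moreover have *: "max 0 t = (\<bar>t\<bar> + t) / 2" for t :: real by auto
  ultimately show ?thesis
    unfolding dtv_prod_def excess_def *
    by (simp add: sum.distrib sum_divide_distrib[symmetric])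
qed

text \<open>Projecting to one coordinate does not increase total variation: the positive part of a
  sum over a slice is at most the sum of the positive parts.\<close>

lemma coordinate_le_excess:
  assumes i: "i < n"
  shows "1 - (\<Sum>c<q. mn i c) \<le> excess q P Q n 1 1"
proof -
  let ?X = "PiE {..<n} (\<lambda>_. {..<q})"
  let ?f = "\<lambda>R x. \<Prod>j<n. R j (x j)"
  \<comment> \<open>The slice with symbol \<open>c\<close> at coordinate \<open>i\<close> is again a
    product set, with a singleton factor, so the sum over it factors.\<close>
  have marg: "(\<Sum>x\<in>{x\<in>?X. x i = c}. ?f R x) = R i c"
    if c: "c < q" and R: "marginals q n R" for c and R :: "nat \<Rightarrow> nat \<Rightarrow> real"
  proof -
    let ?B = "\<lambda>j. if j = i then {c} else {..<q}"
    have "{x\<in>?X. x i = c} = PiE {..<n} ?B"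
    proof (intro equalityI subsetI)
      fix x assume "x \<in> {x\<in>?X. x i = c}"
      then show "x \<in> PiE {..<n} ?B" by (simp add: PiE_iff)
    next
      fix x assume x: "x \<in> PiE {..<n} ?B"
      have "x \<in> ?X" using subsetD[OF PiE_mono x, of "\<lambda>_. {..<q}"] c by simp
      then show "x \<in> {x\<in>?X. x i = c}" using PiE_mem[OF x, of i] i by simp
    qed
    then have "(\<Sum>x\<in>{x\<in>?X. x i = c}. ?f R x) = (\<Prod>j<n. \<Sum>d\<in>?B j. R j d)"
      by (simp add: prod_sum_PiE)
    also have "\<dots> = (\<Prod>j<n. if j = i then R i c else 1)"
      using R by (intro prod.cong) (auto simp: marginals_def)
    also have "\<dots> = R i c" using i by simp
    finally show ?thesis .
  qed
  have "1 - (\<Sum>c<q. mn i c) = (\<Sum>c<q. P i c - mn i c)"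
    using i by (simp add: sum_subtractf P_sum)
  also have "\<dots> = (\<Sum>c<q. max 0 (P i c - Q i c))"
    by (intro sum.cong) (auto simp: min_marg_def)
  also have "\<dots> \<le> (\<Sum>c<q. \<Sum>x\<in>{x\<in>?X. x i = c}. max 0 (?f P x - ?f Q x))"
  proof (rule sum_mono)
    fix c assume "c \<in> {..<q}"
    then have "P i c - Q i c = (\<Sum>x\<in>{x\<in>?X. x i = c}. ?f P x - ?f Q x)"
      using marg[of c P] marg[of c Q] P Q by (simp add: sum_subtractf)
    also have "\<dots> \<le> (\<Sum>x\<in>{x\<in>?X. x i = c}. max 0 (?f P x - ?f Q x))"
      by (intro sum_mono) auto
    finally show "max 0 (P i c - Q i c) \<le> (\<Sum>x\<in>{x\<in>?X. x i = c}. max 0 (?f P x - ?f Q x))"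
      by (simp add: sum_nonneg)
  qed
  also have "\<dots> = (\<Sum>x\<in>?X. max 0 (?f P x - ?f Q x))"
    using i by (intro sum.group) (auto simp: PiE_iff intro!: finite_PiE)
  finally show ?thesis by (simp add: excess_def)
qed

text \<open>The coupling fails at some coordinate, and each coordinate contributes at most the full
  distance. Hence the estimator has mean at least \<open>1 / n\<close>.\<close>

lemma overlap_gap_le:
  "1 - G n \<le> real n * excess q P Q n 1 1"
proof -
  have "1 - G n \<le> (\<Sum>i<n. 1 - (\<Sum>c<q. mn i c))"
    using prod_ge_1_minus_sum[of "{..<n}" "\<lambda>i. \<Sum>c<q. mn i c"] mn_sum
    by (simp add: overlap_def)
  also have "\<dots> \<le> (\<Sum>i<n. excess q P Q n 1 1)"
    by (intro sum_mono coordinate_le_excess) auto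
  finally show ?thesis by simp
qed

section \<open>Averaging independent samples\<close>

definition sample_pmf :: "real pmf" where
  "sample_pmf = map_pmf ratio (iter_pmf (extend_pmf q P Q) n (1, 1, 1))"

definition total_pmf :: "nat \<Rightarrow> real pmf" where
  "total_pmf N = iter_pmf (\<lambda>_ s. map_pmf (\<lambda>x. s + x) sample_pmf) N 0"

lemma dtv_eq_0: "1 \<le> G n \<Longrightarrow> dtv_prod q n P Q = 0"
  using excess_le[of n 1 1 1] excess_nonneg[of n 1 1] by (simp add: dtv_eq_excess)

lemma estimator_concentration:
  assumes G: "G n < 1" and e: "0 < e" "e \<le> 1" and d: "0 < d" and n: "0 < n"
    and N: "4 * real n * ln (2 / d) / e\<^sup>2 \<le> real N" "0 < N"
  defines "dtv \<equiv> dtv_prod q n P Q"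
  shows "measure_pmf.prob (total_pmf N)
    {s. (1 - e) * dtv \<le> (1 - G n) * s / real N \<and> (1 - G n) * s / real N \<le> (1 + e) * dtv} \<ge> 1 - d"
proof -
  define mu where "mu = measure_pmf.expectation sample_pmf (\<lambda>x. x)"
  have con: "consistent q P Q n (1, 1, 1)" using G by simp
  have fin: "finite (set_pmf sample_pmf)"
    unfolding sample_pmf_def using finite_set_iter_extend[OF _ con] by simp
  have X: "set_pmf sample_pmf \<subseteq> {0..1}"
    unfolding sample_pmf_def using set_iter_extend_consistent[OF _ con] ratio_range by fastforce
  have Z: "(1 - G n) * mu = dtv"
    using expectation_ratio[OF _ con] by (simp add: mu_def sample_pmf_def dtv_def dtv_eq_excess)
  \<comment> \<open>The inequality \<open>overlap_gap_le\<close>, written with the factor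
    \<open>1 - G n\<close> on both sides so that it can be cancelled.\<close>
  have "(1 - G n) * 1 \<le> (1 - G n) * (real n * mu)"
    using overlap_gap_le by (simp only: Z dtv_def dtv_eq_excess mult.left_commute[of "1 - G n"] mult_1_right)
  then have nmu: "1 \<le> real n * mu" using G by simp
  \<comment> \<open>The required number of samples makes the Chernoff exponent at least
    \<open>ln (2 / d)\<close>, because \<open>real n * mu\<close> is at least 1; each tail then
    costs \<open>d / 2\<close>.\<close>
  have "ln (2 / d) \<le> real N * e\<^sup>2 / (4 * real n)"
    using N e n by (simp add: field_simps)
  also have "\<dots> \<le> real N * e\<^sup>2 / (4 * real n) * (real n * mu)"
    using nmu mult_left_mono[of 1 "real n * mu" "real N * e\<^sup>2 / (4 * real n)"] by simp
  also have "\<dots> = real N * mu * e\<^sup>2 / 4" using n by (simp add: field_simps)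
  finally have "exp (- (real N * mu * e\<^sup>2 / 4)) \<le> exp (- ln (2 / d))" by simp
  also have "\<dots> = d / 2" using d by (simp add: exp_minus)
  finally have "1 - d \<le> 1 - 2 * exp (- (real N * mu * e\<^sup>2 / 4))" by simp
  also have "\<dots> \<le> measure_pmf.prob (total_pmf N)
      {s. (1 - e) * (real N * mu) \<le> s \<and> s \<le> (1 + e) * (real N * mu)}"
    unfolding total_pmf_def mu_def by (rule chernoff_iter_pmf[OF fin X e])
  also have "\<dots> \<le> measure_pmf.prob (total_pmf N)
    {s. (1 - e) * dtv \<le> (1 - G n) * s / real N \<and> (1 - G n) * s / real N \<le> (1 + e) * dtv}"
  proof (intro measure_pmf.finite_measure_mono subsetI, safe)
    fix s assume s: "(1 - e) * (real N * mu) \<le> s" "s \<le> (1 + e) * (real N * mu)"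
    have "(1 - e) * dtv * real N = (1 - G n) * ((1 - e) * (real N * mu))"
      by (simp add: Z[symmetric] algebra_simps)
    also have "\<dots> \<le> (1 - G n) * s" using s G by (intro mult_left_mono) auto
    finally show "(1 - e) * dtv \<le> (1 - G n) * s / real N" using N by (simp add: field_simps)
    have "(1 - G n) * s \<le> (1 - G n) * ((1 + e) * (real N * mu))"
      using s G by (intro mult_left_mono) auto
    also have "\<dots> = (1 + e) * dtv * real N" by (simp add: Z[symmetric] algebra_simps)
    finally show "(1 - G n) * s / real N \<le> (1 + e) * dtv" using N by (simp add: field_simps)
  qed simp
  finally show ?thesis .
qed

end

subsection \<open>Structured programs for the machine\<close>

type_synonym mem = "nat \<Rightarrow> real"

text \<open>Sampling has its own constructor, so a \<open>Block\<close> is deterministic and can be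
  treated by \<open>wp\<close>.\<close>

datatype cmd =
    Block "instr list"
  | Draw nat nat
  | Seq cmd cmd (infixr ";;" 60)
  | IfLess nat nat cmd cmd
  | WhileLess nat nat cmd

primrec code_size :: "cmd \<Rightarrow> nat" where
  "code_size (Block is) = length is"
| "code_size (Draw d a) = 1"
| "code_size (c1 ;; c2) = code_size c1 + code_size c2"
| "code_size (IfLess a b c1 c2) = code_size c1 + code_size c2 + 3"
| "code_size (WhileLess a b c) = code_size c + 3"

text \<open>Jump targets are absolute, hence the load address \<open>p\<close>. The branch for a
  failed test comes first. The last \<open>Jmp\<close> of a conditional only leads to the next
  instruction; it makes both branches cost two extra steps, which keeps running times exact.\<close>

primrec compile :: "nat \<Rightarrow> cmd \<Rightarrow> instr list" where
  "compile p (Block is) = is"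
| "compile p (Draw d a) = [Sample d a]"
| "compile p (c1 ;; c2) = compile p c1 @ compile (p + code_size c1) c2"
| "compile p (IfLess a b c1 c2) =
     [JmpLess a b (p + 2 + code_size c2)] @ compile (p + 1) c2
     @ [Jmp (p + 3 + code_size c1 + code_size c2)]
     @ compile (p + 2 + code_size c2) c1
     @ [Jmp (p + 3 + code_size c1 + code_size c2)]"
| "compile p (WhileLess a b c) =
     [JmpLess a b (p + 2), Jmp (p + 3 + code_size c)] @ compile (p + 2) c @ [Jmp p]"

lemma length_compile [simp]: "length (compile p c) = code_size c"
  by (induction c arbitrary: p) auto

section \<open>A program logic with exact running times\<close>

definition code_at :: "instr list \<Rightarrow> nat \<Rightarrow> instr list \<Rightarrow> bool" where
  "code_at prog p is \<longleftrightarrow> (\<exists>ys zs. prog = ys @ is @ zs \<and> length ys = p)"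

lemma code_at_append:
  "code_at prog p (is @ js) \<longleftrightarrow> code_at prog p is \<and> code_at prog (p + length is) js"
proof
  assume "code_at prog p (is @ js)"
  then obtain ys zs where "prog = ys @ is @ js @ zs" "length ys = p"
    by (auto simp: code_at_def)
  then show "code_at prog p is \<and> code_at prog (p + length is) js"
    unfolding code_at_def by (metis append.assoc length_append)
next
  assume *: "code_at prog p is \<and> code_at prog (p + length is) js"
  then obtain ys zs where 1: "prog = ys @ is @ zs" "length ys = p" by (auto simp: code_at_def)
  from * obtain ys' zs' where 2: "prog = ys' @ js @ zs'" "length ys' = p + length is"
    by (auto simp: code_at_def)
  have "(ys @ is) @ zs = ys' @ js @ zs'" using 1 2 by simp
  then have "zs = js @ zs'" using 1 2 by (subst (asm) append_eq_append_conv) auto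
  then show "code_at prog p (is @ js)" using 1 by (auto simp: code_at_def)
qed

lemma code_at_Nil [simp]: "code_at prog p [] \<longleftrightarrow> p \<le> length prog"
proof
  assume "p \<le> length prog"
  then show "code_at prog p []"
    unfolding code_at_def by (intro exI[of _ "take p prog"] exI[of _ "drop p prog"]) simp
qed (auto simp: code_at_def)

lemma code_at_Cons: "code_at prog p (i # is) \<longleftrightarrow>
    p < length prog \<and> prog ! p = i \<and> code_at prog (Suc p) is"
proof -
  have "code_at prog p [i] \<longleftrightarrow> p < length prog \<and> prog ! p = i"
    unfolding code_at_def
    by (auto simp: nth_append) (metis id_take_nth_drop length_take min.absorb4)
  then show ?thesis using code_at_append[of prog p "[i]" "is"] by simp
qed

text \<open>Weakest preconditions of straight-line code. The witness \<open>p\<close> for an address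
  expresses that the access does not fault; jumps and \<open>Sample\<close> fall under the last
  clause.\<close>

fun wp :: "instr list \<Rightarrow> mem \<Rightarrow> (mem \<Rightarrow> bool) \<Rightarrow> bool" where
  "wp [] m \<Phi> = \<Phi> m"
| "wp (LoadConst d k # is) m \<Phi> = wp is (m(d := of_int k)) \<Phi>"
| "wp (Arith f d a b # is) m \<Phi> = wp is (m(d := aop_eval f (m a) (m b))) \<Phi>"
| "wp (Load d a # is) m \<Phi> = (\<exists>p. m a = real p \<and> wp is (m(d := m p)) \<Phi>)"
| "wp (Store a v # is) m \<Phi> = (\<exists>p. m a = real p \<and> wp is (m(p := m v)) \<Phi>)"
| "wp _ m \<Phi> = False"

text \<open>The running time \<open>k\<close> is exact, so it must not depend on the random choices.
  The joint distribution \<open>J\<close> couples an abstract random value with the final memory; it allows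
  the memory to contain further registers about which nothing is known.\<close>

definition executes :: "nat \<Rightarrow> cmd \<Rightarrow> mem \<Rightarrow> nat \<Rightarrow> ('a \<times> mem) pmf \<Rightarrow> bool" where
  "executes q c m k J \<longleftrightarrow> (\<forall>prog p T. code_at prog p (compile p c) \<longrightarrow>
     run q prog (k + T) (p, m) = bind_pmf J (\<lambda>s. run q prog T (p + code_size c, snd s)))"

definition spec :: "nat \<Rightarrow> cmd \<Rightarrow> mem \<Rightarrow> nat \<Rightarrow> 'a pmf \<Rightarrow> ('a \<Rightarrow> mem \<Rightarrow> bool) \<Rightarrow> bool" where
  "spec q c m k X R \<longleftrightarrow>
     (\<exists>J. map_pmf fst J = X \<and> (\<forall>s \<in> set_pmf J. R (fst s) (snd s)) \<and> executes q c m k J)"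

abbreviation dspec :: "nat \<Rightarrow> cmd \<Rightarrow> mem \<Rightarrow> nat \<Rightarrow> (mem \<Rightarrow> bool) \<Rightarrow> bool" where
  "dspec q c m k \<Phi> \<equiv> spec q c m k (return_pmf ()) (\<lambda>_. \<Phi>)"

lemma wp_run:
  assumes "wp is m \<Phi>"
  shows "\<exists>m'. \<Phi> m' \<and> (\<forall>prog p T. code_at prog p is \<longrightarrow>
     run q prog (length is + T) (p, m) = run q prog T (p + length is, m'))"
  using assms
proof (induction "is" m \<Phi> rule: wp.induct)
  case (2 d k "is" m \<Phi>)
  then show ?case by (fastforce simp: code_at_Cons step_def bind_return_pmf)
next
  case (3 f d a b "is" m \<Phi>)
  then show ?case by (fastforce simp: code_at_Cons step_def bind_return_pmf)
next
  case (4 d a "is" m \<Phi>)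
  then obtain p where p: "m a = real p" "wp is (m(d := m p)) \<Phi>" by auto
  from "4.IH"[OF p(2)] obtain m' where "\<Phi> m'" "\<And>prog pc T. code_at prog pc is \<Longrightarrow>
     run q prog (length is + T) (pc, m(d := m p)) = run q prog T (pc + length is, m')" by blast
  then show ?case by (intro exI[of _ m']) (simp add: code_at_Cons step_def bind_return_pmf p(1))
next
  case (5 a v "is" m \<Phi>)
  then obtain p where p: "m a = real p" "wp is (m(p := m v)) \<Phi>" by auto
  from "5.IH"[OF p(2)] obtain m' where "\<Phi> m'" "\<And>prog pc T. code_at prog pc is \<Longrightarrow>
     run q prog (length is + T) (pc, m(p := m v)) = run q prog T (pc + length is, m')" by blast
  then show ?case by (intro exI[of _ m']) (simp add: code_at_Cons step_def bind_return_pmf p(1))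
qed auto

lemma spec_Block:
  assumes "wp is m (R a)"
  shows "spec q (Block is) m (length is) (return_pmf a) R"
proof -
  obtain m' where "R a m'" "\<And>prog p T. code_at prog p is \<Longrightarrow>
     run q prog (length is + T) (p, m) = run q prog T (p + length is, m')"
    using wp_run[OF assms, of q] by blast
  then show ?thesis unfolding spec_def executes_def
    by (intro exI[of _ "return_pmf (a, m')"]) (auto simp: bind_return_pmf)
qed

lemma spec_Draw:
  assumes a: "m a = real p" and W: "\<And>c. c < q \<Longrightarrow> m (p + c) = w c"
    and nn: "\<And>c. c < q \<Longrightarrow> 0 \<le> w c" and one: "(\<Sum>c<q. w c) = 1"
  defines "X \<equiv> embed_pmf (\<lambda>c. if c < q then w c else 0)"
  shows "spec q (Draw d a) m 1 X (\<lambda>c m'. m' = m(d := real c))"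
proof -
  have e: "(\<lambda>c. if c < q then m (nat \<lfloor>m a\<rfloor> + c) else 0) = (\<lambda>c. if c < q then w c else 0)"
    using W by (auto simp: a)
  show ?thesis unfolding spec_def executes_def
    by (rule exI[of _ "map_pmf (\<lambda>c. (c, m(d := real c))) X"])
       (auto simp: map_pmf_comp code_at_Cons step_def bind_map_pmf e a nn W one X_def)
qed

lemma spec_conseq:
  assumes "spec q c m k X R" "k = k'" "X = X'"
    "\<And>a m'. a \<in> set_pmf X \<Longrightarrow> R a m' \<Longrightarrow> R' a m'"
  shows "spec q c m k' X' R'"
proof -
  obtain J where J: "map_pmf fst J = X" "\<forall>s\<in>set_pmf J. R (fst s) (snd s)" "executes q c m k J"
    using assms(1) by (auto simp: spec_def)
  have "fst s \<in> set_pmf X" if "s \<in> set_pmf J" for s using J(1) that by force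
  with J assms(2-4) show ?thesis unfolding spec_def by (intro exI[of _ J]) fast
qed

text \<open>Couplings compose. The second coupling is chosen separately for each pair of abstract
  value and memory, since the memory may hold registers not determined by the value.\<close>

lemma joint_bind:
  assumes J: "map_pmf fst J = X" "\<forall>s\<in>set_pmf J. R (fst s) (snd s)"
    and 2: "\<And>a m'. a \<in> set_pmf X \<Longrightarrow> R a m' \<Longrightarrow> spec q c m' k (Y a) R'"
  obtains J2 where "map_pmf fst (bind_pmf J J2) = bind_pmf X Y"
    "\<forall>s\<in>set_pmf (bind_pmf J J2). R' (fst s) (snd s)"
    "\<And>s. s \<in> set_pmf J \<Longrightarrow> executes q c (snd s) k (J2 s)"
proof -
  have "fst s \<in> set_pmf X" if "s \<in> set_pmf J" for s using J(1) that by force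
  then have "\<forall>s\<in>set_pmf J. spec q c (snd s) k (Y (fst s)) R'" using J 2 by blast
  then have "\<exists>J2. \<forall>s\<in>set_pmf J. map_pmf fst (J2 s) = Y (fst s) \<and>
     (\<forall>t\<in>set_pmf (J2 s). R' (fst t) (snd t)) \<and> executes q c (snd s) k (J2 s)"
    unfolding spec_def by (rule bchoice)
  then obtain J2 where J2: "\<And>s. s \<in> set_pmf J \<Longrightarrow> map_pmf fst (J2 s) = Y (fst s)"
     "\<And>s. s \<in> set_pmf J \<Longrightarrow> \<forall>t\<in>set_pmf (J2 s). R' (fst t) (snd t)"
     "\<And>s. s \<in> set_pmf J \<Longrightarrow> executes q c (snd s) k (J2 s)"
    by blast
  moreover have "map_pmf fst (bind_pmf J J2) = bind_pmf X Y"
    unfolding J(1)[symmetric]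
    by (auto simp: map_bind_pmf bind_map_pmf J2(1) intro!: bind_pmf_cong)
  ultimately show ?thesis using that[of J2] by auto
qed

lemma spec_Seq:
  assumes 1: "spec q c1 m k1 X R"
    and 2: "\<And>a m'. a \<in> set_pmf X \<Longrightarrow> R a m' \<Longrightarrow> spec q c2 m' k2 (Y a) R'"
  shows "spec q (c1 ;; c2) m (k1 + k2) (bind_pmf X Y) R'"
proof -
  obtain J where J: "map_pmf fst J = X" "\<forall>s\<in>set_pmf J. R (fst s) (snd s)" "executes q c1 m k1 J"
    using 1 by (auto simp: spec_def)
  obtain J2 where J2: "map_pmf fst (bind_pmf J J2) = bind_pmf X Y"
    "\<forall>s\<in>set_pmf (bind_pmf J J2). R' (fst s) (snd s)"
    "\<And>s. s \<in> set_pmf J \<Longrightarrow> executes q c2 (snd s) k2 (J2 s)"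
    by (rule joint_bind[where q=q and c=c2 and k=k2 and Y=Y and R'=R', OF J(1,2) 2]) blast+
  have "executes q (c1 ;; c2) m (k1 + k2) (bind_pmf J J2)" unfolding executes_def
  proof (intro allI impI)
    fix prog p T assume "code_at prog p (compile p (c1 ;; c2))"
    then have c: "code_at prog p (compile p c1)"
      "code_at prog (p + code_size c1) (compile (p + code_size c1) c2)"
      by (auto simp: code_at_append)
    have "run q prog (k1 + (k2 + T)) (p, m)
        = bind_pmf J (\<lambda>s. run q prog (k2 + T) (p + code_size c1, snd s))"
      using J(3) c(1) unfolding executes_def by blast
    also have "\<dots> = bind_pmf J (\<lambda>s. bind_pmf (J2 s)
        (\<lambda>t. run q prog T (p + code_size c1 + code_size c2, snd t)))"
      using J2(3) c(2) unfolding executes_def by (intro bind_pmf_cong refl) blast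
    finally show "run q prog (k1 + k2 + T) (p, m)
        = bind_pmf (bind_pmf J J2) (\<lambda>s. run q prog T (p + code_size (c1 ;; c2), snd s))"
      by (simp add: bind_assoc_pmf add.assoc)
  qed
  with J2 show ?thesis unfolding spec_def by blast
qed

lemma spec_dSeq:
  assumes "dspec q c1 m k1 \<Phi>" "\<And>m'. \<Phi> m' \<Longrightarrow> spec q c2 m' k2 Y R"
  shows "spec q (c1 ;; c2) m (k1 + k2) Y R"
  using spec_Seq[OF assms(1), of c2 k2 "\<lambda>_. Y" R] assms(2) by (simp add: bind_return_pmf)

lemma run_JmpLess:
  "code_at prog p [JmpLess a b t] \<Longrightarrow>
    run q prog (Suc T) (p, m) = run q prog T (if m a < m b then t else Suc p, m)"
  by (simp add: code_at_Cons step_def bind_return_pmf)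

lemma run_Jmp:
  "code_at prog p [Jmp t] \<Longrightarrow> run q prog (Suc T) (p, m) = run q prog T (t, m)"
  by (simp add: code_at_Cons step_def bind_return_pmf)

lemma spec_IfLess:
  assumes "m a < m b \<Longrightarrow> spec q c1 m k X R" "\<not> m a < m b \<Longrightarrow> spec q c2 m k X R"
  shows "spec q (IfLess a b c1 c2) m (k + 2) X R"
proof -
  define c where "c = (if m a < m b then c1 else c2)"
  have "spec q c m k X R" using assms by (simp add: c_def)
  then obtain J where J: "map_pmf fst J = X" "\<forall>s\<in>set_pmf J. R (fst s) (snd s)" "executes q c m k J"
    by (auto simp: spec_def)
  have "executes q (IfLess a b c1 c2) m (k + 2) J" unfolding executes_def
  proof (intro allI impI)
    fix prog p T
    let ?end = "p + 3 + code_size c1 + code_size c2"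
    \<comment> \<open>The entry address of the branch taken. Either branch is followed by a jump to
      \<open>?end\<close>, so one argument serves both.\<close>
    define s where "s = (if m a < m b then p + 2 + code_size c2 else Suc p)"
    assume "code_at prog p (compile p (IfLess a b c1 c2))"
    then have cs: "code_at prog p [JmpLess a b (p + 2 + code_size c2)]"
      "code_at prog s (compile s c)" "code_at prog (s + code_size c) [Jmp ?end]"
      by (auto simp: code_at_Cons code_at_append s_def c_def ac_simps)
    have "run q prog (k + 2 + T) (p, m) = run q prog (k + Suc T) (s, m)"
      using run_JmpLess[OF cs(1), of q "k + Suc T" m] by (simp add: s_def)
    also have "\<dots> = bind_pmf J (\<lambda>t. run q prog (Suc T) (s + code_size c, snd t))"
      using J(3) cs(2) unfolding executes_def by blast
    also have "\<dots> = bind_pmf J (\<lambda>t. run q prog T (?end, snd t))"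
      using run_Jmp[OF cs(3)] by simp
    finally show "run q prog (k + 2 + T) (p, m)
        = bind_pmf J (\<lambda>s. run q prog T (p + code_size (IfLess a b c1 c2), snd s))"
      by (simp add: ac_simps)
  qed
  with J show ?thesis unfolding spec_def by blast
qed

lemma spec_While_False:
  assumes "\<not> m x < m y" "R a m"
  shows "spec q (WhileLess x y c) m 2 (return_pmf a) R"
proof -
  have "executes q (WhileLess x y c) m 2 (return_pmf (a, m))" unfolding executes_def
  proof (intro allI impI)
    fix prog p T
    assume "code_at prog p (compile p (WhileLess x y c))"
    then have cs: "code_at prog p [JmpLess x y (p + 2)]"
      "code_at prog (Suc p) [Jmp (p + 3 + code_size c)]"
      by (auto simp: code_at_Cons code_at_append)
    show "run q prog (2 + T) (p, m) = bind_pmf (return_pmf (a, m))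
        (\<lambda>s. run q prog T (p + code_size (WhileLess x y c), snd s))"
      using run_JmpLess[OF cs(1), of q "Suc T" m] run_Jmp[OF cs(2), of q T m] assms
      by (simp add: bind_return_pmf ac_simps)
  qed
  then show ?thesis using assms unfolding spec_def by (intro exI[of _ "return_pmf (a, m)"]) auto
qed

lemma spec_While_True:
  assumes xy: "m x < m y" and 1: "spec q c m k1 X R"
    and 2: "\<And>a m'. a \<in> set_pmf X \<Longrightarrow> R a m' \<Longrightarrow> spec q (WhileLess x y c) m' k2 (Y a) R'"
  shows "spec q (WhileLess x y c) m (k1 + 2 + k2) (bind_pmf X Y) R'"
proof -
  let ?W = "WhileLess x y c"
  obtain J where J: "map_pmf fst J = X" "\<forall>s\<in>set_pmf J. R (fst s) (snd s)" "executes q c m k1 J"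
    using 1 by (auto simp: spec_def)
  obtain J2 where J2: "map_pmf fst (bind_pmf J J2) = bind_pmf X Y"
    "\<forall>s\<in>set_pmf (bind_pmf J J2). R' (fst s) (snd s)"
    "\<And>s. s \<in> set_pmf J \<Longrightarrow> executes q ?W (snd s) k2 (J2 s)"
    by (rule joint_bind[where q=q and c="?W" and k=k2 and Y=Y and R'=R', OF J(1,2) 2]) blast+
  have "executes q ?W m (k1 + 2 + k2) (bind_pmf J J2)" unfolding executes_def
  proof (intro allI impI)
    fix prog p T assume W: "code_at prog p (compile p ?W)"
    then have cs: "code_at prog p [JmpLess x y (p + 2)]"
      "code_at prog (p + 2) (compile (p + 2) c)" "code_at prog (p + 2 + code_size c) [Jmp p]"
      by (auto simp: code_at_Cons code_at_append)
    have "run q prog (k1 + 2 + k2 + T) (p, m) = run q prog (k1 + Suc (k2 + T)) (p + 2, m)"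
      using run_JmpLess[OF cs(1), of q "k1 + Suc (k2 + T)" m] xy by (simp add: ac_simps)
    also have "\<dots> = bind_pmf J (\<lambda>s. run q prog (Suc (k2 + T)) (p + 2 + code_size c, snd s))"
      using J(3) cs(2) unfolding executes_def by blast
    also have "\<dots> = bind_pmf J (\<lambda>s. run q prog (k2 + T) (p, snd s))"
      using run_Jmp[OF cs(3)] by simp
    also have "\<dots> = bind_pmf J (\<lambda>s. bind_pmf (J2 s)
        (\<lambda>t. run q prog T (p + code_size ?W, snd t)))"
      using J2(3) W unfolding executes_def by (intro bind_pmf_cong refl) blast
    finally show "run q prog (k1 + 2 + k2 + T) (p, m)
        = bind_pmf (bind_pmf J J2) (\<lambda>s. run q prog T (p + code_size ?W, snd s))"
      by (simp add: bind_assoc_pmf)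
  qed
  with J2 show ?thesis unfolding spec_def by blast
qed

text \<open>The invariant is indexed by the number of iterations still to come, as in
  \<open>iter_pmf\<close>. An iteration adds a test and a jump back; leaving the loop takes a failed
  test and a jump.\<close>

lemma spec_While:
  assumes "\<And>i a m. i < N \<Longrightarrow> I (Suc i) a m \<Longrightarrow> m x < m y \<and> spec q c m t (F i a) (I i)"
    and "\<And>a m. I 0 a m \<Longrightarrow> \<not> m x < m y" and "I N a m"
  shows "spec q (WhileLess x y c) m (N * (t + 2) + 2) (iter_pmf F N a) (I 0)"
  using assms
proof (induction N arbitrary: a m)
  case 0
  then show ?case using spec_While_False[of m x y "I 0" a q c] by (simp add: numeral_2_eq_2)
next
  case (Suc N)
  have "spec q (WhileLess x y c) m (t + 2 + (N * (t + 2) + 2)) (bind_pmf (F N a) (iter_pmf F N)) (I 0)"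
  proof (rule spec_While_True[where R="I N"])
    show "m x < m y" "spec q c m t (F N a) (I N)" using Suc.prems(1)[of N] Suc.prems(3) by auto
    show "spec q (WhileLess x y c) m' (N * (t + 2) + 2) (iter_pmf F N a') (I 0)"
      if "I N a' m'" for a' m'
      by (rule Suc.IH) (use Suc.prems(1)[OF less_SucI] Suc.prems(2) that in blast)+
  qed
  then show ?case by (simp add: algebra_simps)
qed

lemma iter_pmf_return: "iter_pmf (\<lambda>_. return_pmf) N a = return_pmf a"
  by (induction N) (auto simp: bind_return_pmf)

text \<open>Loops over symbols have length \<open>q\<close>, which is fixed with the program, so
  they are unrolled; the symbol can then occur inside a register number.\<close>

primrec unroll :: "(nat \<Rightarrow> cmd) \<Rightarrow> nat \<Rightarrow> cmd" where
  "unroll g 0 = Block []"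
| "unroll g (Suc n) = unroll g n ;; g n"

lemma dspec_While:
  assumes "\<And>i m. i < N \<Longrightarrow> I (Suc i) m \<Longrightarrow> m x < m y \<and> dspec q c m t (I i)"
    and "\<And>m. I 0 m \<Longrightarrow> \<not> m x < m y" and "I N m"
  shows "dspec q (WhileLess x y c) m (N * (t + 2) + 2) (I 0)"
  using spec_While[of N "\<lambda>i _. I i" x y q c t "\<lambda>_. return_pmf" "()" m] assms
  by (simp add: iter_pmf_return)

lemma dspec_unroll:
  assumes "\<And>c m. c < N \<Longrightarrow> I c m \<Longrightarrow> dspec q (g c) m t (I (Suc c))" and "I 0 m"
  shows "dspec q (unroll g N) m (N * t) (I N)"
  using assms
proof (induction N)
  case 0
  then show ?case using spec_Block[of "[]" m "\<lambda>_. I 0" "()"] by simp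
next
  case (Suc N)
  have "dspec q (unroll g N ;; g N) m (N * t + t) (I (Suc N))"
    by (rule spec_dSeq[where \<Phi>="I N"]) (auto intro!: Suc)
  then show ?case by (simp add: add.commute)
qed

lemma run_halted: "length prog \<le> fst s \<Longrightarrow> run q prog T s = return_pmf s"
  by (induction T) (auto simp: step_def bind_return_pmf case_prod_unfold)

text \<open>A halted state is a fixed point of \<open>step\<close>, so time beyond the exact running
  time is harmless.\<close>

lemma spec_run:
  assumes "spec q c m k X R" "k \<le> T"
  shows "\<exists>J. map_pmf fst J = X \<and> (\<forall>s\<in>set_pmf J. R (fst s) (snd s)) \<and>
     run q (compile 0 c) T (0, m) = map_pmf (\<lambda>s. (code_size c, snd s)) J"
proof -
  obtain J where J: "map_pmf fst J = X" "\<forall>s\<in>set_pmf J. R (fst s) (snd s)" "executes q c m k J"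
    using assms by (auto simp: spec_def)
  have "code_at (compile 0 c) 0 (compile 0 c)" by (auto simp: code_at_def)
  then have "run q (compile 0 c) (k + (T - k)) (0, m)
      = bind_pmf J (\<lambda>s. run q (compile 0 c) (T - k) (0 + code_size c, snd s))"
    using J(3) unfolding executes_def by blast
  then show ?thesis using assms(2) J(1,2)
    by (intro exI[of _ J]) (auto simp: run_halted map_pmf_def)
qed

subsection \<open>The algorithm\<close>

lemma dspec_Block: "wp is m \<Phi> \<Longrightarrow> length is = k \<Longrightarrow> dspec q (Block is) m k \<Phi>"
  using spec_Block[of "is" m "\<lambda>_. \<Phi>" "()" q] by simp

text \<open>Lets the simplifier find the address witnesses required by \<open>wp\<close>.\<close>

lemma real_add_eq_real_iff [simp]:
  "real x + 1 = real p \<longleftrightarrow> p = Suc x" "1 + real x = real p \<longleftrightarrow> p = Suc x"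
  "real x + real y = real p \<longleftrightarrow> p = x + y"
  by auto

text \<open>Initially only registers 0, 1, 2 are at fixed addresses outside the marginals, so scratch
  space has to be created without knowing where the input ends. Doubling register 0 turns \<open>n\<close> into
  an address \<open>b = 2 ^ (2 * q + 40) * n\<close> beyond the input; \<open>eps\<close> is saved there, which frees
  register 1 for the constant 1, and then input register \<open>j\<close> is moved to \<open>b + j - 1\<close>.
  Afterwards registers below \<open>32 + q\<close> are scratch, with \<open>b\<close>, \<open>1\<close>, \<open>n\<close>, \<open>eps\<close>, \<open>delta\<close> in
  0, 1, 3, 4, 5, and the array of overlaps starts at \<open>2 * b\<close>. Later on register 11 holds the number
  of samples required, 12 and 13 count and add up the samples, 14 to 16 hold the state \<open>(A, B, D)\<close>,
  17 the number of open coordinates, 18 to 20 point into the tables of \<open>P\<close>, \<open>Q\<close> and the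
  overlaps, and 32 to \<open>31 + q\<close> hold the distribution of the next symbol.\<close>

definition relocate_code :: "nat \<Rightarrow> cmd" where
  "relocate_code q =
     Block (replicate (2 * q + 40) (Arith AAdd 0 0 0) @ [Store 0 1, LoadConst 1 1]) ;;
     unroll (\<lambda>j. Block [Arith AAdd 0 0 1, Store 0 (j + 2)]) (q + 30) ;;
     Block [LoadConst 2 (int q + 30), Arith ASub 0 0 2]"

text \<open>Dividing \<open>b\<close> by the power of two recovers \<open>n\<close>;
  \<open>eps\<close> and \<open>delta\<close> sit at \<open>b\<close> and \<open>b + 1\<close> after
  the move.\<close>

definition setup_code :: "nat \<Rightarrow> cmd" where
  "setup_code q = Block [LoadConst 3 (2 ^ (2 * q + 40)), Arith ADiv 3 0 3, Load 4 0,
     Arith AAdd 5 0 1, Load 5 5]"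

text \<open>Continues the move of the input from register \<open>32 + q\<close> on, now with a
  genuine loop, since the registers below are free.\<close>

definition copy_code :: "nat \<Rightarrow> cmd" where
  "copy_code q =
     Block [LoadConst 6 (32 + int q), LoadConst 7 (2 * int q), Arith AMul 7 7 3, LoadConst 8 3,
       Arith AAdd 7 7 8, Arith AAdd 8 0 6, Arith ASub 8 8 1] ;;
     WhileLess 6 7 (Block [Load 9 6, Store 8 9, Arith AAdd 6 6 1, Arith AAdd 8 8 1])"

text \<open>Registers 7, 8 and 9 run upwards through the tables of \<open>P\<close>,
  \<open>Q\<close> and the overlaps. Their final values are the starting points for sampling, which
  runs downwards.\<close>

definition overlap_code :: "nat \<Rightarrow> cmd" where
  "overlap_code q =
     Block [LoadConst 6 0, LoadConst 7 2, Arith AAdd 7 0 7, LoadConst 8 (int q), Arith AMul 8 8 3,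
       Arith AAdd 8 7 8, Arith AAdd 9 0 0, LoadConst 10 1, Store 9 10] ;;
     WhileLess 6 3 (
       Block [LoadConst 11 0] ;;
       unroll (\<lambda>c.
         Block [Load 12 7, Load 13 8] ;;
         IfLess 12 13 (Block [Arith AAdd 11 11 12]) (Block [Arith AAdd 11 11 13]) ;;
         Block [Arith AAdd 7 7 1, Arith AAdd 8 8 1]) q ;;
       Block [Arith AMul 10 10 11, Arith AAdd 9 9 1, Store 9 10, Arith AAdd 6 6 1])"

text \<open>The machine has no logarithm: the number of doublings that take \<open>delta\<close> to
  at least 2 replaces it.\<close>

definition log_code :: cmd where
  "log_code =
     Block [LoadConst 6 2, LoadConst 11 0] ;;
     WhileLess 5 6 (Block [Arith AAdd 5 5 5, Arith AAdd 11 11 1])"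

text \<open>The required number of samples stays unrounded, as the machine has no floor; comparing
  an integer counter with it rounds up implicitly.\<close>

definition bound_code :: "nat \<Rightarrow> cmd" where
  "bound_code q =
     Block [LoadConst 12 4, Arith AMul 11 11 3, Arith AMul 11 11 12, Arith ADiv 11 11 4,
       Arith ADiv 11 11 4, LoadConst 12 0, LoadConst 13 0, LoadConst 21 0, LoadConst 22 (int q),
       LoadConst 23 32]"

definition weights_code :: "nat \<Rightarrow> cmd" where
  "weights_code q =
     unroll (\<lambda>c.
       Block [Load 26 18, Load 27 19] ;;
       IfLess 26 27 (Block [Arith AMul 28 26 25]) (Block [Arith AMul 28 27 25]) ;;
       Block [Arith AMul 26 14 26, Arith ASub 26 26 28, Arith ADiv (32 + c) 26 24,
         Arith AAdd 18 18 1, Arith AAdd 19 19 1]) q"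

text \<open>Pointers 18 and 19 step back one row, are advanced over it by
  \<open>weights_code\<close>, and are reset, so that the drawn symbol in register 29 serves as an
  offset.\<close>

definition extend_code :: "nat \<Rightarrow> cmd" where
  "extend_code q =
     Block [Arith ASub 17 17 1, Load 24 20, Arith ASub 20 20 1, Load 25 20, Arith AMul 24 15 24,
       Arith ASub 24 14 24, Arith AMul 25 15 25, Arith ASub 18 18 22, Arith ASub 19 19 22] ;;
     weights_code q ;;
     Block [Arith ASub 18 18 22, Arith ASub 19 19 22] ;;
     Draw 29 23 ;;
     Block [Arith AAdd 26 18 29, Load 26 26, Arith AAdd 27 19 29, Load 27 27] ;;
     IfLess 26 27 (Block [Arith AMul 15 15 26]) (Block [Arith AMul 15 15 27]) ;;
     Block [Arith AMul 14 14 26, Arith AMul 16 16 27]"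

text \<open>Register 21 holds 0, so adding it copies a register.\<close>

definition sample_code :: "nat \<Rightarrow> cmd" where
  "sample_code q =
     Block [Arith AAdd 14 21 1, Arith AAdd 15 21 1, Arith AAdd 16 21 1, Arith AAdd 17 21 3,
       Arith AAdd 18 21 7, Arith AAdd 19 21 8, Arith AAdd 20 21 9] ;;
     WhileLess 21 17 (extend_code q) ;;
     Block [Arith ASub 24 14 16, Arith ASub 25 14 15] ;;
     IfLess 14 16 (Block [LoadConst 24 0]) (Block [Arith ADiv 24 24 25]) ;;
     Block [Arith AAdd 13 13 24, Arith AAdd 12 12 1]"

definition estimate_code :: "nat \<Rightarrow> cmd" where
  "estimate_code q =
     log_code ;; bound_code q ;; WhileLess 12 11 (sample_code q) ;;
     Block [Arith ASub 24 1 10, Arith AMul 24 24 13, Arith ADiv 0 24 12]"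

definition program :: "nat \<Rightarrow> cmd" where
  "program q =
     relocate_code q ;; setup_code q ;;
     IfLess 4 1
       (copy_code q ;; overlap_code q ;; IfLess 10 1 (estimate_code q) (Block [LoadConst 0 0]))
       (Block [LoadConst 0 0])"

lemma wp_replicate_double:
  "wp (replicate k (Arith AAdd 0 0 0) @ is) m \<Phi> \<longleftrightarrow> wp is (m(0 := 2 ^ k * m 0)) \<Phi>"
  by (induction k arbitrary: m) (auto simp: algebra_simps)

section \<open>Memory layout and preparation of the tables\<close>

locale memory_layout = marginal_pair +
  fixes b :: nat and eps delta :: real
  assumes n_pos: "0 < n" and b_def: "b = 2 ^ (2 * q + 40) * n"
    and delta: "0 < delta" "delta < 1"
begin

text \<open>Keeps the scratch registers, the relocated input between \<open>b\<close> and
  \<open>2 * b\<close>, and the overlaps from \<open>2 * b\<close> on apart, and puts the original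
  input below \<open>b\<close>.\<close>

lemma b_ge: "2 * q + 40 < b" "2 + 2 * (n * q) < b"
proof -
  have 2: "2 * q + 40 < 2 ^ (2 * q + 40)" by (rule less_exp)
  also have "\<dots> \<le> b" using n_pos by (simp add: b_def)
  finally show "2 * q + 40 < b" .
  have "2 + 2 * (n * q) < (2 * q + 40) * n" using n_pos by (simp add: algebra_simps)
  also have "\<dots> \<le> b" using 2 unfolding b_def by (intro mult_right_mono) auto
  finally show "2 + 2 * (n * q) < b" .
qed

abbreviation "M0 \<equiv> init_mem q n eps delta P Q"

definition relocated :: "mem \<Rightarrow> bool" where
  "relocated m \<longleftrightarrow> m 0 = real b \<and> m 1 = 1 \<and> (\<forall>a<q + 31. m (b + a) = M0 (Suc a))
     \<and> (\<forall>a. 32 + q \<le> a \<longrightarrow> a < b \<longrightarrow> m a = M0 a)"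

lemma relocate_correct:
  "dspec q (relocate_code q) M0 (4 * q + 104) relocated"
proof -
  let ?I = "\<lambda>j m. m 0 = real (b + j) \<and> m 1 = 1 \<and> (\<forall>a. j + 2 \<le> a \<longrightarrow> a < b \<longrightarrow> m a = M0 a) \<and>
     (\<forall>a<j + 1. m (b + a) = M0 (Suc a))"
  have M00: "2 ^ (2 * q + 40) * M0 0 = real b" by (simp add: init_mem_def b_def)
  have 1: "dspec q (Block (replicate (2 * q + 40) (Arith AAdd 0 0 0) @ [Store 0 1, LoadConst 1 1]))
     M0 (2 * q + 42) (?I 0)"
    by (rule dspec_Block) (use b_ge in \<open>auto simp: wp_replicate_double M00\<close>)
  have 2: "dspec q (unroll (\<lambda>j. Block [Arith AAdd 0 0 1, Store 0 (j + 2)]) (q + 30)) m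
      ((q + 30) * 2) (?I (q + 30))" if "?I 0 m" for m
  proof (rule dspec_unroll)
    fix j m assume j: "j < q + 30" and I: "?I j m"
    define p where "p = b + j"
    have m: "m 0 = real p" "m 1 = 1" "\<And>a. j + 2 \<le> a \<Longrightarrow> a < b \<Longrightarrow> m a = M0 a"
      "\<And>a. a < j + 1 \<Longrightarrow> m (b + a) = M0 (Suc a)" "b \<le> p" using I by (auto simp: p_def)
    have p: "Suc p \<noteq> 0" "Suc p \<noteq> 1" "j + 2 < b" using b_ge j by (auto simp: p_def)
    show "dspec q (Block [Arith AAdd 0 0 1, Store 0 (j + 2)]) m 2 (?I (Suc j))"
      by (rule dspec_Block) (use m p in \<open>auto simp: p_def less_Suc_eq\<close>)
  qed (use that in auto)
  have 3: "dspec q (Block [LoadConst 2 (int q + 30), Arith ASub 0 0 2]) m 2 relocated"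
    if "?I (q + 30) m" for m
    by (rule dspec_Block) (use that b_ge in \<open>auto simp: relocated_def\<close>)
  have "dspec q (relocate_code q) M0 (2 * q + 42 + ((q + 30) * 2 + 2)) relocated"
    unfolding relocate_code_def
    by (rule spec_dSeq[OF 1], rule spec_dSeq[OF 2], assumption, rule 3, assumption)
  then show ?thesis by (simp add: algebra_simps)
qed

definition params :: "mem \<Rightarrow> bool" where
  "params m \<longleftrightarrow> m 0 = real b \<and> m 1 = 1 \<and> m 3 = real n \<and> m 4 = eps"

lemma setup_correct:
  assumes "relocated m"
  shows "dspec q (setup_code q) m 5 (\<lambda>m. relocated m \<and> params m \<and> m 5 = delta)"
proof -
  have M0: "M0 (Suc 0) = eps" "M0 (Suc (Suc 0)) = delta" by (simp_all add: init_mem_def)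
  have "m (b + a) = M0 (Suc a)" if "a < q + 31" for a using assms that by (simp add: relocated_def)
  from this[of 0] this[of 1] have "m b = eps" "m (Suc b) = delta" by (simp_all add: M0)
  moreover have "real b / 2 ^ (2 * q + 40) = real n" by (simp add: b_def)
  ultimately show ?thesis
    using assms b_ge unfolding setup_code_def
    by (intro dspec_Block) (auto simp: relocated_def params_def)
qed

definition data :: "mem \<Rightarrow> bool" where
  "data m \<longleftrightarrow> (\<forall>i<n. \<forall>c<q. m (b + 2 + i * q + c) = P i c \<and> m (b + 2 + n * q + i * q + c) = Q i c)"

lemma index_less: "i < n \<Longrightarrow> c < q \<Longrightarrow> i * q + c < n * q"
  by (metis add_less_cancel_left mult_Suc add.commute less_le_trans mult_le_mono1 Suc_leI)

lemma data_upd [simp]: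
  assumes "a < 32 + q \<or> 2 * b \<le> a"
  shows "data (m(a := v)) = data m"
proof -
  have "b + 2 + i * q + c \<noteq> a" "b + 2 + n * q + i * q + c \<noteq> a" if "i < n" "c < q" for i c
    using assms b_ge index_less[OF that] by auto
  then show ?thesis by (auto simp: data_def)
qed

lemma M0_data:
  assumes "i < n" "c < q"
  shows "M0 (3 + i * q + c) = P i c" "M0 (3 + n * q + i * q + c) = Q i c"
  using index_less[OF assms] assms by (auto simp: init_mem_def)

lemma copy_correct:
  assumes m: "relocated m" "params m" "m 5 = delta"
  shows "dspec q (copy_code q) m (9 + 6 * (2 * n * q + 3 - (32 + q)))
    (\<lambda>m. data m \<and> params m \<and> m 5 = delta)"
proof -
  \<comment> \<open>The maximum covers short inputs that are already moved completely; the loop then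
    makes no iteration.\<close>
  define E where "E = max (32 + q) (2 * n * q + 3)"
  let ?I = "\<lambda>i m. \<exists>j. j + i = E \<and> 32 + q \<le> j \<and> m 6 = real j \<and> m 7 = real (2 * n * q + 3) \<and>
     m 8 = real (b + j) - 1 \<and> params m \<and> m 5 = delta \<and>
     (\<forall>a. Suc a < j \<longrightarrow> m (b + a) = M0 (Suc a)) \<and> (\<forall>a. j \<le> a \<longrightarrow> a < b \<longrightarrow> m a = M0 a)"
  have 1: "dspec q (Block [LoadConst 6 (32 + int q), LoadConst 7 (2 * int q), Arith AMul 7 7 3,
       LoadConst 8 3, Arith AAdd 7 7 8, Arith AAdd 8 0 6, Arith ASub 8 8 1])
     m 7 (?I (E - (32 + q)))"
  proof (rule dspec_Block)
    have E: "32 + q + (E - (32 + q)) = E" by (simp add: E_def)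
    show "wp [LoadConst 6 (32 + int q), LoadConst 7 (2 * int q), Arith AMul 7 7 3,
       LoadConst 8 3, Arith AAdd 7 7 8, Arith AAdd 8 0 6, Arith ASub 8 8 1] m (?I (E - (32 + q)))"
      unfolding wp.simps
      by (rule exI[of _ "32 + q"]) (use m b_ge E in \<open>simp add: relocated_def params_def\<close>)
  qed simp
  have 2: "dspec q (WhileLess 6 7 (Block [Load 9 6, Store 8 9, Arith AAdd 6 6 1, Arith AAdd 8 8 1])) m
     ((E - (32 + q)) * (4 + 2) + 2) (?I 0)" if "?I (E - (32 + q)) m" for m
  proof (rule dspec_While)
    fix i m assume "?I (Suc i) m"
    then obtain j where j: "j + Suc i = E" "32 + q \<le> j" and m: "m 6 = real j"
      "m 7 = real (2 * n * q + 3)" "m 8 = real (b + j) - 1" "m 0 = real b" "m 1 = 1" "m 3 = real n"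
      "m 4 = eps" "m 5 = delta" "\<forall>a. Suc a < j \<longrightarrow> m (b + a) = M0 (Suc a)"
      "\<forall>a. j \<le> a \<longrightarrow> a < b \<longrightarrow> m a = M0 a" by (auto simp: params_def)
    have jE: "j < 2 * n * q + 3" using j by (auto simp: E_def)
    then have jb: "j < b" "m j = M0 j" using b_ge m by auto
    define p where "p = b + j - 1"
    have p: "m 8 = real p" "32 + q \<le> p" "b \<le> p" "Suc p = b + j" "\<And>a. b + a = p \<longleftrightarrow> Suc a = j"
      using m j b_ge by (auto simp: p_def)
    have "dspec q (Block [Load 9 6, Store 8 9, Arith AAdd 6 6 1, Arith AAdd 8 8 1]) m 4 (?I i)"
    proof (rule dspec_Block)
      have Sj: "Suc j + i = E" "32 + q \<le> Suc j" using j by auto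
      show "wp [Load 9 6, Store 8 9, Arith AAdd 6 6 1, Arith AAdd 8 8 1] m (?I i)"
        unfolding wp.simps
        apply (rule exI[of _ j], rule conjI, use m in simp)
        apply (rule exI[of _ p], rule conjI, use p in simp)
        apply (rule exI[of _ "Suc j"])
        using m(1,2,4-) jb p Sj b_ge
        apply (auto simp: params_def less_Suc_eq)
        done
    qed simp
    then show "m 6 < m 7 \<and> dspec q (Block [Load 9 6, Store 8 9, Arith AAdd 6 6 1, Arith AAdd 8 8 1]) m 4 (?I i)"
      unfolding m(1,2) of_nat_less_iff using jE by blast
  next
    fix m assume "?I 0 m"
    then have m: "m 6 = real E" "m 7 = real (2 * n * q + 3)" by auto
    show "\<not> m 6 < m 7" unfolding m of_nat_less_iff by (simp add: E_def)
  qed (rule that)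
  have 3: "data m \<and> params m \<and> m 5 = delta" if "?I 0 m" for m
  proof -
    have *: "m (b + a) = M0 (Suc a)" if "Suc a < 2 * n * q + 3" for a
      using \<open>?I 0 m\<close> that by (auto simp: E_def)
    have "m (b + 2 + i * q + c) = P i c \<and> m (b + 2 + n * q + i * q + c) = Q i c"
      if "i < n" "c < q" for i c
      using *[of "2 + i * q + c"] *[of "2 + n * q + i * q + c"] M0_data[OF that] index_less[OF that]
      by (simp add: add.assoc numeral_3_eq_3)
    then show ?thesis using that by (auto simp: data_def)
  qed
  have "dspec q (copy_code q) m (7 + ((E - (32 + q)) * (4 + 2) + 2)) (?I 0)"
    unfolding copy_code_def by (rule spec_dSeq[OF 1], rule 2, assumption)
  moreover have "7 + ((E - (32 + q)) * (4 + 2) + 2) = 9 + 6 * (2 * n * q + 3 - (32 + q))"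
    by (simp add: E_def max_def)
  ultimately show ?thesis by (rule spec_conseq[OF _ _ refl]) (rule 3)
qed

definition overlap_array :: "nat \<Rightarrow> mem \<Rightarrow> bool" where
  "overlap_array j m \<longleftrightarrow> (\<forall>a\<le>j. m (2 * b + a) = G a)"

lemma overlap_array_upd [simp]:
  "a < 32 + q \<Longrightarrow> overlap_array j (m(a := v)) = overlap_array j m"
  using b_ge by (auto simp: overlap_array_def)

definition tables :: "mem \<Rightarrow> bool" where
  "tables m \<longleftrightarrow> data m \<and> overlap_array n m \<and> params m \<and> m 7 = real (b + 2 + n * q)
     \<and> m 8 = real (b + 2 + n * q + n * q) \<and> m 9 = real (2 * b + n) \<and> m 10 = G n"

lemma overlap_correct:
  assumes m: "data m" "params m" "m 5 = delta"
  shows "dspec q (overlap_code q) m (11 + n * (7 * q + 7)) (\<lambda>m. tables m \<and> m 5 = delta)"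
proof -
  let ?I = "\<lambda>i m. \<exists>j. j + i = n \<and> data m \<and> overlap_array j m \<and> params m \<and> m 5 = delta \<and>
     m 6 = real j \<and> m 7 = real (b + 2 + j * q) \<and> m 8 = real (b + 2 + n * q + j * q) \<and>
     m 9 = real (2 * b + j) \<and> m 10 = G j"
  let ?inner = "\<lambda>c. Block [Load 12 7, Load 13 8] ;;
         IfLess 12 13 (Block [Arith AAdd 11 11 12]) (Block [Arith AAdd 11 11 13]) ;;
         Block [Arith AAdd 7 7 1, Arith AAdd 8 8 1]"
  let ?body = "Block [LoadConst 11 0] ;; unroll ?inner q ;;
       Block [Arith AMul 10 10 11, Arith AAdd 9 9 1, Store 9 10, Arith AAdd 6 6 1]"
  have 1: "dspec q (Block [LoadConst 6 0, LoadConst 7 2, Arith AAdd 7 0 7, LoadConst 8 (int q),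
       Arith AMul 8 8 3, Arith AAdd 8 7 8, Arith AAdd 9 0 0, LoadConst 10 1, Store 9 10]) m 9 (?I n)"
    by (rule dspec_Block)
       (use m b_ge in \<open>auto simp: params_def overlap_array_def overlap_def algebra_simps\<close>)
  have body: "dspec q ?body m (1 + (q * 7 + 4)) (?I i)" if i: "i < n" "?I (Suc i) m" for i m
  proof -
    obtain j where j: "j + Suc i = n" and m: "data m" "overlap_array j m" "params m" "m 5 = delta"
     "m 6 = real j" "m 7 = real (b + 2 + j * q)" "m 8 = real (b + 2 + n * q + j * q)"
     "m 9 = real (2 * b + j)" "m 10 = G j" using i by auto
    have jn: "j < n" using j by simp
    let ?J = "\<lambda>c m. data m \<and> overlap_array j m \<and> params m \<and> m 5 = delta \<and>
     m 6 = real j \<and> m 7 = real (b + 2 + j * q + c) \<and> m 8 = real (b + 2 + n * q + j * q + c) \<and>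
     m 9 = real (2 * b + j) \<and> m 10 = G j \<and> m 11 = (\<Sum>d<c. mn j d)"
    have b1: "dspec q (Block [LoadConst 11 0]) m 1 (?J 0)"
      by (rule dspec_Block) (use m in \<open>auto simp: params_def\<close>)
    have b2: "dspec q (unroll ?inner q) m (q * 7) (?J q)" if "?J 0 m" for m
    proof (rule dspec_unroll[where I="?J"])
      fix c m assume c: "c < q" and J: "?J c m"
      define p r where "p = b + 2 + j * q + c" and "r = b + 2 + n * q + j * q + c"
      have m: "m p = P j c" "m r = Q j c" "m 7 = real p" "m 8 = real r" "data m" "overlap_array j m"
        "params m" "m 5 = delta" "m 6 = real j" "m 9 = real (2 * b + j)" "m 10 = G j"
        "m 11 = (\<Sum>d<c. mn j d)"
        using J c jn by (auto simp: p_def r_def data_def)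
      have pr: "32 + q \<le> p" "32 + q \<le> r" using b_ge by (auto simp: p_def r_def)
      let ?A = "\<lambda>m. data m \<and> overlap_array j m \<and> params m \<and> m 5 = delta \<and> m 6 = real j \<and>
        m 9 = real (2 * b + j) \<and> m 10 = G j \<and> m 7 = real p \<and> m 8 = real r"
      have "dspec q (Block [Load 12 7, Load 13 8]) m 2
          (\<lambda>m. ?A m \<and> m 11 = (\<Sum>d<c. mn j d) \<and> m 12 = P j c \<and> m 13 = Q j c)"
        by (rule dspec_Block) (use m pr in \<open>auto simp: params_def\<close>)
      moreover have "dspec q (IfLess 12 13 (Block [Arith AAdd 11 11 12]) (Block [Arith AAdd 11 11 13]))
          m (1 + 2) (\<lambda>m. ?A m \<and> m 11 = (\<Sum>d<Suc c. mn j d))"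
        if "?A m \<and> m 11 = (\<Sum>d<c. mn j d) \<and> m 12 = P j c \<and> m 13 = Q j c" for m
        by (rule spec_IfLess; rule dspec_Block) (use that in \<open>auto simp: params_def min_marg_def\<close>)
      moreover have "dspec q (Block [Arith AAdd 7 7 1, Arith AAdd 8 8 1]) m 2 (?J (Suc c))"
        if "?A m \<and> m 11 = (\<Sum>d<Suc c. mn j d)" for m
        by (rule dspec_Block) (use that in \<open>auto simp: params_def p_def r_def\<close>)
      ultimately have "dspec q (?inner c) m (2 + (1 + 2 + 2)) (?J (Suc c))"
        by (intro spec_dSeq)
      then show "dspec q (?inner c) m 7 (?J (Suc c))" by simp
    qed (use that in auto)
    have b3: "dspec q (Block [Arith AMul 10 10 11, Arith AAdd 9 9 1, Store 9 10, Arith AAdd 6 6 1]) m 4 (?I i)"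
      if J: "?J q m" for m
    proof (rule dspec_Block)
      define p where "p = 2 * b + j"
      have m: "data m" "overlap_array j m" "params m" "m 5 = delta" "m 6 = real j"
        "m 7 = real (b + 2 + j * q + q)" "m 8 = real (b + 2 + n * q + j * q + q)" "m 10 = G j"
        "m 11 = (\<Sum>d<q. mn j d)" using J by auto
      have S: "m 9 = real p" "32 + q \<le> p" "2 * b \<le> p" "Suc p = 2 * b + Suc j" using J b_ge by (auto simp: p_def)
      have ov: "overlap_array (Suc j) (m'(a := v))"
        if "overlap_array j m'" "a = 2 * b + Suc j" "v = G (Suc j)" for m' a v
        using that by (auto simp: overlap_array_def le_Suc_eq)
      show "wp [Arith AMul 10 10 11, Arith AAdd 9 9 1, Store 9 10, Arith AAdd 6 6 1] m (?I i)"
        unfolding wp.simps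
        apply (rule exI[of _ "Suc p"], rule conjI, use m S in \<open>simp add: params_def\<close>)
        apply (rule exI[of _ "Suc j"])
        using m S b_ge j apply (simp add: params_def overlap_Suc ov)
        done
    qed simp
    show ?thesis by (rule spec_dSeq[OF b1], rule spec_dSeq[OF b2], assumption, rule b3, assumption)
  qed
  have 2: "dspec q (WhileLess 6 3 ?body) m (n * (1 + (q * 7 + 4) + 2) + 2) (?I 0)" if "?I n m" for m
    by (rule dspec_While) (use that body in \<open>auto simp: params_def\<close>)
  have "dspec q (overlap_code q) m (9 + (n * (1 + (q * 7 + 4) + 2) + 2)) (?I 0)"
    unfolding overlap_code_def by (rule spec_dSeq[OF 1], rule 2, assumption)
  then show ?thesis
    by (rule spec_conseq) (auto simp: tables_def algebra_simps)
qed

lemma tables_upd [simp]: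
  assumes "a < 32 + q" "a \<notin> {0, 1, 3, 4, 7, 8, 9, 10}"
  shows "tables (m(a := v)) = tables m"
  using assms by (auto simp: tables_def params_def)

section \<open>The number of samples\<close>

definition reps :: nat where
  "reps = nat \<lceil>log 2 (2 / delta)\<rceil>"

text \<open>The right-hand side is the loop test of \<open>log_code\<close> after \<open>j\<close>
  doublings.\<close>

lemma less_reps_iff: "j < reps \<longleftrightarrow> delta * 2 ^ j < 2"
proof -
  have "j < reps \<longleftrightarrow> real j < log 2 (2 / delta)"
    unfolding reps_def zless_nat_eq_int_zless less_ceiling_iff by simp
  also have "\<dots> \<longleftrightarrow> 2 ^ j < 2 / delta"
    using delta by (subst less_log_iff) (auto simp: powr_realpow)
  also have "\<dots> \<longleftrightarrow> delta * 2 ^ j < 2"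
    using delta by (simp add: field_simps)
  finally show ?thesis .
qed

lemma log_correct:
  assumes "tables m" "m 5 = delta"
  shows "dspec q log_code m (4 + 4 * reps) (\<lambda>m. tables m \<and> m 11 = real reps)"
proof -
  let ?I = "\<lambda>i m. \<exists>j. j + i = reps \<and> tables m \<and> m 5 = delta * 2 ^ j \<and> m 6 = 2 \<and> m 11 = real j"
  let ?body = "Block [Arith AAdd 5 5 5, Arith AAdd 11 11 1]"
  have 1: "dspec q (Block [LoadConst 6 2, LoadConst 11 0]) m 2 (?I reps)"
    by (rule dspec_Block) (use assms in auto)
  have 2: "dspec q (WhileLess 5 6 ?body) m (reps * (2 + 2) + 2) (?I 0)" if "?I reps m" for m
  proof (rule dspec_While[where I="?I"])
    fix i m assume "?I (Suc i) m"
    then obtain j where j: "j + Suc i = reps" and m: "tables m" "m 5 = delta * 2 ^ j" "m 6 = 2"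
      "m 11 = real j" by blast
    have "m 1 = 1" using m by (simp add: tables_def params_def)
    then have "dspec q ?body m 2 (?I i)"
      by (intro dspec_Block) (use j m in \<open>auto intro!: exI[of _ "Suc j"]\<close>)
    moreover have "m 5 < m 6" using j less_reps_iff[of j] by (simp add: m)
    ultimately show "m 5 < m 6 \<and> dspec q ?body m 2 (?I i)" by blast
  next
    fix m assume "?I 0 m"
    then show "\<not> m 5 < m 6" using less_reps_iff[of reps] by auto
  qed (rule that)
  have "dspec q log_code m (2 + (reps * (2 + 2) + 2)) (?I 0)"
    unfolding log_code_def by (rule spec_dSeq[OF 1], rule 2, assumption)
  moreover have "2 + (reps * (2 + 2) + 2) = 4 + 4 * reps" by simp
  ultimately show ?thesis by (rule spec_conseq[OF _ _ refl]) auto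
qed

text \<open>The demand of \<open>estimator_concentration\<close>, with \<open>reps\<close> in place
  of the smaller \<open>ln (2 / delta)\<close>.\<close>

definition bound :: real where
  "bound = real reps * real n * 4 / eps / eps"

definition samples :: nat where
  "samples = nat \<lceil>bound\<rceil>"

definition ready :: "mem \<Rightarrow> bool" where
  "ready m \<longleftrightarrow> tables m \<and> m 11 = bound \<and> m 21 = 0 \<and> m 22 = real q \<and> m 23 = 32"

lemma ready_upd [simp]:
  assumes "a < 32 + q" "a \<notin> {0, 1, 3, 4, 7, 8, 9, 10, 11, 21, 22, 23}"
  shows "ready (m(a := v)) = ready m"
  using assms by (auto simp: ready_def)

lemma bound_correct:
  assumes "tables m" "m 11 = real reps"
  shows "dspec q (bound_code q) m 10 (\<lambda>m. ready m \<and> m 12 = 0 \<and> m 13 = 0)"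
proof -
  have "m 3 = real n" "m 4 = eps" using assms by (auto simp: tables_def params_def)
  with assms show ?thesis unfolding bound_code_def
    by (intro dspec_Block) (simp_all add: ready_def bound_def)
qed

section \<open>Drawing one sample\<close>

definition sampling :: "real \<Rightarrow> real \<Rightarrow> nat \<Rightarrow> real \<times> real \<times> real \<Rightarrow> mem \<Rightarrow> bool" where
  "sampling cnt acc i = (\<lambda>(A, B, D) m. ready m \<and> m 12 = cnt \<and> m 13 = acc \<and> m 14 = A \<and> m 15 = B
     \<and> m 16 = D \<and> m 17 = real i \<and> m 20 = real (2 * b + i))"

lemma sampling_upd [simp]:
  assumes "a < 32 + q" "a \<notin> {0, 1, 3, 4, 7, 8, 9, 10, 11, 12, 13, 14, 15, 16, 17, 20, 21, 22, 23}"
  shows "sampling cnt acc i s (m(a := v)) = sampling cnt acc i s m"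
  using assms by (auto simp: sampling_def)

text \<open>Kept apart from \<open>sampling\<close> because \<open>weights_code\<close> advances
  these two registers while the state stays fixed.\<close>

definition pointers :: "nat \<Rightarrow> mem \<Rightarrow> bool" where
  "pointers k m \<longleftrightarrow> m 18 = real (b + 2 + k) \<and> m 19 = real (b + 2 + n * q + k)"

lemma pointers_upd [simp]:
  "a \<notin> {18, 19} \<Longrightarrow> pointers k (m(a := v)) = pointers k m"
  by (auto simp: pointers_def)

lemma weights_correct:
  assumes i: "i < n" and m: "sampling cnt acc i (A, B, D) m" "pointers (i * q) m"
    "m 24 = A - B * G (Suc i)" "m 25 = B * G i"
  shows "dspec q (weights_code q) m (q * 10) (\<lambda>m. sampling cnt acc i (A, B, D) m \<and>
    pointers (i * q + q) m \<and> (\<forall>d<q. m (32 + d) = weight q P Q i A B d))"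
proof -
  let ?I = "\<lambda>c m. sampling cnt acc i (A, B, D) m \<and> pointers (i * q + c) m \<and>
    m 24 = A - B * G (Suc i) \<and> m 25 = B * G i \<and> (\<forall>d<c. m (32 + d) = weight q P Q i A B d)"
  let ?inner = "\<lambda>c. Block [Load 26 18, Load 27 19] ;;
       IfLess 26 27 (Block [Arith AMul 28 26 25]) (Block [Arith AMul 28 27 25]) ;;
       Block [Arith AMul 26 14 26, Arith ASub 26 26 28, Arith ADiv (32 + c) 26 24,
         Arith AAdd 18 18 1, Arith AAdd 19 19 1]"
  have "dspec q (unroll ?inner q) m (q * 10) (?I q)"
  proof (rule dspec_unroll[where I="?I"])
    fix c m assume c: "c < q" and I: "?I c m"
    define p r where "p = b + 2 + (i * q + c)" and "r = b + 2 + n * q + (i * q + c)"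
    have "data m" using I by (auto simp: sampling_def ready_def tables_def)
    then have "m p = P i c" "m r = Q i c"
      using c i unfolding p_def r_def data_def by (simp_all add: add.assoc)
    moreover have "32 + q \<le> p" "32 + q \<le> r" "m 18 = real p" "m 19 = real r"
      using b_ge I by (auto simp: p_def r_def pointers_def)
    ultimately have "dspec q (Block [Load 26 18, Load 27 19]) m 2
        (\<lambda>m. ?I c m \<and> m 26 = P i c \<and> m 27 = Q i c)"
      by (intro dspec_Block) (use I in auto)
    moreover have "dspec q (IfLess 26 27 (Block [Arith AMul 28 26 25]) (Block [Arith AMul 28 27 25]))
        m (1 + 2) (\<lambda>m. ?I c m \<and> m 26 = P i c \<and> m 28 = mn i c * (B * G i))"
      if "?I c m \<and> m 26 = P i c \<and> m 27 = Q i c" for m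
      by (rule spec_IfLess; rule dspec_Block)
         (use that in \<open>auto simp: min_marg_def\<close>)
    moreover have "dspec q (Block [Arith AMul 26 14 26, Arith ASub 26 26 28, Arith ADiv (32 + c) 26 24,
         Arith AAdd 18 18 1, Arith AAdd 19 19 1]) m 5 (?I (Suc c))"
      if J: "?I c m \<and> m 26 = P i c \<and> m 28 = mn i c * (B * G i)" for m
    proof (rule dspec_Block)
      have "m 1 = 1" "m 14 = A"
        using J by (auto simp: sampling_def ready_def tables_def params_def)
      then show "wp [Arith AMul 26 14 26, Arith ASub 26 26 28, Arith ADiv (32 + c) 26 24,
         Arith AAdd 18 18 1, Arith AAdd 19 19 1] m (?I (Suc c))"
        using J c by (auto simp: pointers_def weight_def less_Suc_eq)
    qed simp
    ultimately have "dspec q (?inner c) m (2 + (1 + 2 + 5)) (?I (Suc c))"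
      by (intro spec_dSeq)
    then show "dspec q (?inner c) m 10 (?I (Suc c))" by simp
  qed (use m in auto)
  then show ?thesis unfolding weights_code_def
    by (rule spec_conseq[OF _ refl refl]) blast
qed

text \<open>Consistency belongs to the invariant: it makes the stored weights a valid distribution,
  without which \<open>Sample\<close> would fault.\<close>

definition sample_inv :: "real \<Rightarrow> real \<Rightarrow> nat \<Rightarrow> real \<times> real \<times> real \<Rightarrow> mem \<Rightarrow> bool" where
  "sample_inv cnt acc i s m \<longleftrightarrow> consistent q P Q i s \<and> sampling cnt acc i s m \<and> pointers (i * q) m"

lemma extend_correct:
  assumes i: "i < n" and m: "sample_inv cnt acc (Suc i) s m"
  shows "spec q (extend_code q) m (10 * q + 21) (extend_pmf q P Q i s) (sample_inv cnt acc i)"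
proof -
  obtain A B D where s: "s = (A, B, D)" by (cases s)
  have con: "consistent q P Q (Suc i) (A, B, D)" using m by (simp add: sample_inv_def s)
  have 1: "dspec q (Block [Arith ASub 17 17 1, Load 24 20, Arith ASub 20 20 1, Load 25 20,
       Arith AMul 24 15 24, Arith ASub 24 14 24, Arith AMul 25 15 25, Arith ASub 18 18 22,
       Arith ASub 19 19 22]) m 9
     (\<lambda>m. sampling cnt acc i s m \<and> pointers (i * q) m \<and> m 24 = A - B * G (Suc i) \<and> m 25 = B * G i)"
  proof (rule dspec_Block)
    define p where "p = 2 * b + i"
    have "m (2 * b + a) = G a" if "a \<le> n" for a
      using m that by (simp add: sample_inv_def sampling_def ready_def tables_def overlap_array_def s)
    from this[of i] this[of "Suc i"] have "m (Suc p) = G (Suc i)" "m p = G i"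
      using i by (simp_all add: p_def)
    moreover have "m 20 = real p + 1" "32 + q \<le> p" "m 17 = real i + 1"
      "m 1 = 1" "m 22 = real q" "m 14 = A" "m 15 = B" "m 16 = D" "m 12 = cnt" "m 13 = acc" "ready m"
      "m 18 = real (b + 2 + i * q) + q" "m 19 = real (b + 2 + n * q + i * q) + q"
      using m i b_ge by (auto simp: p_def sample_inv_def sampling_def ready_def tables_def
          params_def pointers_def s)
    ultimately show "wp [Arith ASub 17 17 1, Load 24 20, Arith ASub 20 20 1, Load 25 20,
       Arith AMul 24 15 24, Arith ASub 24 14 24, Arith AMul 25 15 25, Arith ASub 18 18 22,
       Arith ASub 19 19 22] m (\<lambda>m. sampling cnt acc i s m \<and> pointers (i * q) m \<and>
       m 24 = A - B * G (Suc i) \<and> m 25 = B * G i)"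
      by (simp add: sampling_def pointers_def s) (simp add: p_def)
  qed simp
  let ?W = "\<lambda>k m. sampling cnt acc i s m \<and> pointers k m \<and>
    (\<forall>d<q. m (32 + d) = weight q P Q i A B d)"
  have 2: "dspec q (weights_code q) m (q * 10) (?W (i * q + q))"
    if "sampling cnt acc i s m \<and> pointers (i * q) m \<and> m 24 = A - B * G (Suc i) \<and> m 25 = B * G i" for m
    using weights_correct[OF i] that by (simp add: s)
  have 3: "dspec q (Block [Arith ASub 18 18 22, Arith ASub 19 19 22]) m 2 (?W (i * q))"
    if "?W (i * q + q) m" for m
  proof (rule dspec_Block)
    have "m 22 = real q" using that by (auto simp: sampling_def ready_def s)
    then show "wp [Arith ASub 18 18 22, Arith ASub 19 19 22] m (?W (i * q))"
      using that by (auto simp: pointers_def)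
  qed simp
  have 4: "spec q (Draw 29 23) m 1 (symbol_pmf q P Q i A B) (\<lambda>c m. ?W (i * q) m \<and> m 29 = real c)"
    if W: "?W (i * q) m" for m
  proof -
    have "m 23 = real 32" using that by (auto simp: sampling_def ready_def s)
    then have "spec q (Draw 29 23) m 1 (symbol_pmf q P Q i A B) (\<lambda>c m'. m' = m(29 := real c))"
      unfolding symbol_pmf_def
      by (rule spec_Draw) (use W weight_nonneg[OF i _ con] sum_weight[OF i con] in auto)
    then show ?thesis
      by (rule spec_conseq[OF _ refl refl]) (use W in auto)
  qed
  have 5: "spec q (Block [Arith AAdd 26 18 29, Load 26 26, Arith AAdd 27 19 29, Load 27 27] ;;
     IfLess 26 27 (Block [Arith AMul 15 15 26]) (Block [Arith AMul 15 15 27]) ;;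
     Block [Arith AMul 14 14 26, Arith AMul 16 16 27]) m 9
     (return_pmf (A * P i c, B * mn i c, D * Q i c)) (sample_inv cnt acc i)"
    if W: "?W (i * q) m \<and> m 29 = real c" and c: "c \<in> set_pmf (symbol_pmf q P Q i A B)" for m c
  proof -
    \<comment> \<open>A drawn symbol lies in the support, so its weight is nonzero and the extended
      state is consistent again.\<close>
    have cq: "c < q" and w: "weight q P Q i A B c \<noteq> 0"
      using c by (auto simp: set_pmf_eq pmf_symbol_pmf[OF i con] split: if_splits)
    define p r where "p = b + 2 + i * q + c" and "r = b + 2 + n * q + i * q + c"
    let ?K = "\<lambda>B m. sampling cnt acc i (A, B, D) m \<and> pointers (i * q) m \<and>
      m 26 = P i c \<and> m 27 = Q i c"
    have "dspec q (Block [Arith AAdd 26 18 29, Load 26 26, Arith AAdd 27 19 29, Load 27 27]) m 4 (?K B)"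
    proof (rule dspec_Block)
      have "data m" using W by (auto simp: sampling_def ready_def tables_def s)
      then have m: "m p = P i c" "m r = Q i c" "32 + q \<le> p" "32 + q \<le> r"
        "sampling cnt acc i (A, B, D) m" "pointers (i * q) m"
        using cq i b_ge W unfolding p_def r_def data_def by (auto simp: s)
      have pr: "m 18 + m 29 = real p" "m 19 + m 29 = real r"
        using W by (auto simp: p_def r_def pointers_def)
      show "wp [Arith AAdd 26 18 29, Load 26 26, Arith AAdd 27 19 29, Load 27 27] m (?K B)"
        using m pr by simp
    qed simp
    moreover have "dspec q (IfLess 26 27 (Block [Arith AMul 15 15 26]) (Block [Arith AMul 15 15 27])) m
        (1 + 2) (?K (B * mn i c))" if "?K B m" for m
      by (rule spec_IfLess; rule dspec_Block)
         (use that in \<open>auto simp: min_marg_def sampling_def\<close>)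
    moreover have "spec q (Block [Arith AMul 14 14 26, Arith AMul 16 16 27]) m
        (length [Arith AMul 14 14 26, Arith AMul 16 16 27])
        (return_pmf (A * P i c, B * mn i c, D * Q i c)) (sample_inv cnt acc i)"
      if "?K (B * mn i c) m" for m
      by (rule spec_Block)
         (use that consistent_extend[OF i con cq w] in
           \<open>simp add: sample_inv_def sampling_def pointers_def\<close>)
    ultimately have "spec q (Block [Arith AAdd 26 18 29, Load 26 26, Arith AAdd 27 19 29, Load 27 27] ;;
     IfLess 26 27 (Block [Arith AMul 15 15 26]) (Block [Arith AMul 15 15 27]) ;;
     Block [Arith AMul 14 14 26, Arith AMul 16 16 27]) m
      (4 + (1 + 2 + length [Arith AMul 14 14 26, Arith AMul 16 16 27]))
     (return_pmf (A * P i c, B * mn i c, D * Q i c)) (sample_inv cnt acc i)"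
      by (intro spec_dSeq)
    then show ?thesis by simp
  qed
  have "spec q (extend_code q) m (9 + (q * 10 + (2 + (1 + 9))))
      (bind_pmf (symbol_pmf q P Q i A B) (\<lambda>c. return_pmf (A * P i c, B * mn i c, D * Q i c)))
      (sample_inv cnt acc i)"
    unfolding extend_code_def
    by (rule spec_dSeq[OF 1], rule spec_dSeq[OF 2], assumption, rule spec_dSeq[OF 3], assumption,
        rule spec_Seq[OF 4], assumption, rule 5, assumption+)
  then show ?thesis
    by (rule spec_conseq) (auto simp: extend_pmf_def s map_pmf_def)
qed

lemma sample_correct:
  assumes G: "G n < 1" and m: "ready m" "m 12 = cnt" "m 13 = acc"
  shows "spec q (sample_code q) m (n * (10 * q + 23) + 16) (map_pmf (\<lambda>x. acc + x) sample_pmf)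
    (\<lambda>s m. ready m \<and> m 12 = cnt + 1 \<and> m 13 = s)"
proof -
  let ?X = "iter_pmf (extend_pmf q P Q) n (1, 1, 1)"
  have 1: "dspec q (Block [Arith AAdd 14 21 1, Arith AAdd 15 21 1, Arith AAdd 16 21 1, Arith AAdd 17 21 3,
       Arith AAdd 18 21 7, Arith AAdd 19 21 8, Arith AAdd 20 21 9]) m 7 (sample_inv cnt acc n (1, 1, 1))"
  proof (rule dspec_Block)
    have "m 21 = 0" "m 1 = 1" "m 3 = real n" "m 7 = real (b + 2 + n * q)"
      "m 8 = real (b + 2 + n * q + n * q)" "m 9 = real (2 * b + n)"
      using m by (auto simp: ready_def tables_def params_def)
    \<comment> \<open>The assumption \<open>G n < 1\<close> is the consistency of the initial state
      \<open>(1, 1, 1)\<close>.\<close>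
    then show "wp [Arith AAdd 14 21 1, Arith AAdd 15 21 1, Arith AAdd 16 21 1, Arith AAdd 17 21 3,
       Arith AAdd 18 21 7, Arith AAdd 19 21 8, Arith AAdd 20 21 9] m (sample_inv cnt acc n (1, 1, 1))"
      using m G by (simp add: sample_inv_def sampling_def pointers_def)
  qed simp
  have 2: "spec q (WhileLess 21 17 (extend_code q)) m (n * (10 * q + 21 + 2) + 2) ?X
      (sample_inv cnt acc 0)" if "sample_inv cnt acc n (1, 1, 1) m" for m
  proof (rule spec_While)
    fix i s m assume "i < n" and I: "sample_inv cnt acc (Suc i) s m"
    moreover have "m 21 < m 17" using I by (cases s) (auto simp: sample_inv_def sampling_def ready_def)
    ultimately show "m 21 < m 17 \<and>
      spec q (extend_code q) m (10 * q + 21) (extend_pmf q P Q i s) (sample_inv cnt acc i)"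
      using extend_correct by blast
  next
    fix s m assume "sample_inv cnt acc 0 s m"
    then show "\<not> m 21 < m 17" by (cases s) (auto simp: sample_inv_def sampling_def ready_def)
  qed (rule that)
  have 3: "spec q (Block [Arith ASub 24 14 16, Arith ASub 25 14 15] ;;
     IfLess 14 16 (Block [LoadConst 24 0]) (Block [Arith ADiv 24 24 25]) ;;
     Block [Arith AAdd 13 13 24, Arith AAdd 12 12 1]) m 7 (return_pmf (acc + ratio s))
     (\<lambda>s m. ready m \<and> m 12 = cnt + 1 \<and> m 13 = s)" if I: "sample_inv cnt acc 0 s m" for s m
  proof -
    obtain A B D where s: "s = (A, B, D)" by (cases s)
    let ?K = "\<lambda>m. ready m \<and> m 12 = cnt \<and> m 13 = acc"
    have "dspec q (Block [Arith ASub 24 14 16, Arith ASub 25 14 15]) m 2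
      (\<lambda>m. ?K m \<and> m 14 = A \<and> m 16 = D \<and> m 24 = A - D \<and> m 25 = A - B)"
      by (rule dspec_Block) (use I in \<open>auto simp: sample_inv_def sampling_def s\<close>)
    moreover have "dspec q (IfLess 14 16 (Block [LoadConst 24 0]) (Block [Arith ADiv 24 24 25])) m
        (1 + 2) (\<lambda>m. ?K m \<and> m 24 = ratio s)"
      if "?K m \<and> m 14 = A \<and> m 16 = D \<and> m 24 = A - D \<and> m 25 = A - B" for m
      by (rule spec_IfLess; rule dspec_Block) (use that in \<open>auto simp: s max_def\<close>)
    moreover have "spec q (Block [Arith AAdd 13 13 24, Arith AAdd 12 12 1]) m
        (length [Arith AAdd 13 13 24, Arith AAdd 12 12 1]) (return_pmf (acc + ratio s))
        (\<lambda>s m. ready m \<and> m 12 = cnt + 1 \<and> m 13 = s)" if "?K m \<and> m 24 = ratio s" for m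
    proof (rule spec_Block)
      have "m 1 = 1" using that by (auto simp: ready_def tables_def params_def)
      moreover have "ready (m(13 := v, 12 := w))" for v w
        using that by (auto simp: ready_def)
      ultimately show "wp [Arith AAdd 13 13 24, Arith AAdd 12 12 1] m
        (\<lambda>m. ready m \<and> m 12 = cnt + 1 \<and> m 13 = acc + ratio s)" using that by simp
    qed
    ultimately have "spec q (Block [Arith ASub 24 14 16, Arith ASub 25 14 15] ;;
     IfLess 14 16 (Block [LoadConst 24 0]) (Block [Arith ADiv 24 24 25]) ;;
     Block [Arith AAdd 13 13 24, Arith AAdd 12 12 1]) m
     (2 + (1 + 2 + length [Arith AAdd 13 13 24, Arith AAdd 12 12 1])) (return_pmf (acc + ratio s))
     (\<lambda>s m. ready m \<and> m 12 = cnt + 1 \<and> m 13 = s)"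
      by (intro spec_dSeq)
    then show ?thesis by simp
  qed
  have "spec q (sample_code q) m (7 + (n * (10 * q + 21 + 2) + 2 + 7))
      (bind_pmf ?X (\<lambda>s. return_pmf (acc + ratio s))) (\<lambda>s m. ready m \<and> m 12 = cnt + 1 \<and> m 13 = s)"
    unfolding sample_code_def
    by (rule spec_dSeq[OF 1], rule spec_Seq[OF 2], assumption, rule 3, assumption)
  then show ?thesis
    by (rule spec_conseq) (auto simp: sample_pmf_def map_pmf_comp map_pmf_def[symmetric])
qed

section \<open>The complete program\<close>

lemma estimate_correct:
  assumes G: "G n < 1" and m: "tables m" "m 5 = delta"
  shows "spec q (estimate_code q) m (4 * reps + samples * (n * (10 * q + 23) + 18) + 19)
    (map_pmf (\<lambda>s. (1 - G n) * s / real samples) (total_pmf samples)) (\<lambda>v m. m 0 = v)"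
proof -
  let ?F = "\<lambda>(_ :: nat) s. map_pmf (\<lambda>x. s + x) sample_pmf"
  let ?I = "\<lambda>i s m. \<exists>j. j + i = samples \<and> ready m \<and> m 12 = real j \<and> m 13 = s"
  let ?t = "n * (10 * q + 23) + 16"
  have 1: "spec q (WhileLess 12 11 (sample_code q)) m (samples * (?t + 2) + 2)
     (iter_pmf ?F samples 0) (?I 0)" if "ready m \<and> m 12 = 0 \<and> m 13 = 0" for m
  proof (rule spec_While[where I="?I"])
    fix i s m assume "?I (Suc i) s m"
    then obtain j where j: "j + Suc i = samples" and m: "ready m" "m 12 = real j" "m 13 = s" by blast
    have "spec q (sample_code q) m ?t (?F i s) (?I i)"
      by (rule spec_conseq[OF sample_correct[OF G m] refl refl])
         (use j in \<open>auto intro!: exI[of _ "Suc j"]\<close>)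
    \<comment> \<open>A natural number lies below \<open>bound\<close> exactly if it lies below its
      ceiling, so the loop makes exactly \<open>samples\<close> iterations.\<close>
    moreover have "real j < bound"
      using j unfolding samples_def by (simp add: less_ceiling_iff zless_nat_eq_int_zless) linarith
    then have "m 12 < m 11" using m by (simp add: ready_def)
    ultimately show "m 12 < m 11 \<and> spec q (sample_code q) m ?t (?F i s) (?I i)" by blast
  next
    fix s m assume "?I 0 s m"
    then have "m 12 = real samples" "m 11 = bound" by (auto simp: ready_def)
    then show "\<not> m 12 < m 11" by (simp add: samples_def not_less) linarith
  qed (use that in auto)
  have 2: "spec q (Block [Arith ASub 24 1 10, Arith AMul 24 24 13, Arith ADiv 0 24 12]) m
      (length [Arith ASub 24 1 10, Arith AMul 24 24 13, Arith ADiv 0 24 12])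
      (return_pmf ((1 - G n) * s / real samples)) (\<lambda>v m. m 0 = v)" if "?I 0 s m" for m s
    by (rule spec_Block) (use that in \<open>auto simp: ready_def tables_def params_def\<close>)
  have "spec q (estimate_code q) m (4 + 4 * reps + (10 + (samples * (?t + 2) + 2 +
      length [Arith ASub 24 1 10, Arith AMul 24 24 13, Arith ADiv 0 24 12])))
    (bind_pmf (iter_pmf ?F samples 0) (\<lambda>s. return_pmf ((1 - G n) * s / real samples))) (\<lambda>v m. m 0 = v)"
    unfolding estimate_code_def
    by (rule spec_dSeq[OF log_correct[OF m]], rule spec_dSeq[OF bound_correct], blast, blast,
        rule spec_Seq[OF 1], assumption, rule 2, assumption)
  then show ?thesis
    by (rule spec_conseq) (auto simp: total_pmf_def map_pmf_def)
qed

text \<open>The two fallbacks output 0: it is correct for \<open>eps \<ge> 1\<close>, and \<open>G n \<ge> 1\<close> forces \<open>P = Q\<close>.\<close>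

definition runtime :: nat where
  "runtime = (if eps < 1 then
     9 + 6 * (2 * n * q + 3 - (32 + q)) + (11 + n * (7 * q + 7) +
       ((if G n < 1 then 4 * reps + samples * (n * (10 * q + 23) + 18) + 19 else 1) + 2))
     else 1) + 2 + 5 + (4 * q + 104)"

definition output_pmf :: "real pmf" where
  "output_pmf = (if eps < 1 \<and> G n < 1
     then map_pmf (\<lambda>s. (1 - G n) * s / real samples) (total_pmf samples) else return_pmf 0)"

lemma program_correct:
  "spec q (program q) M0 runtime output_pmf (\<lambda>v m. m 0 = v)"
proof -
  let ?R = "\<lambda>v m. m 0 = v"
  have zero: "spec q (Block [LoadConst 0 0]) m 1 (return_pmf (0::real)) ?R" for m
    using spec_Block[of "[LoadConst 0 0]" m ?R 0 q] by simp
  define k1 where "k1 = (if G n < 1 then 4 * reps + samples * (n * (10 * q + 23) + 18) + 19 else 1)"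
  define k2 where "k2 = (if eps < 1 then
     9 + 6 * (2 * n * q + 3 - (32 + q)) + (11 + n * (7 * q + 7) + (k1 + 2)) else 1)"
  have 1: "spec q (IfLess 10 1 (estimate_code q) (Block [LoadConst 0 0])) m (k1 + 2) output_pmf ?R"
    if "tables m \<and> m 5 = delta" "eps < 1" for m
  proof (rule spec_IfLess)
    have m: "m 10 = G n" "m 1 = 1" using that by (auto simp: tables_def params_def)
    show "spec q (estimate_code q) m k1 output_pmf ?R" if "m 10 < m 1"
      using estimate_correct[of m] that[unfolded m] \<open>tables m \<and> m 5 = delta\<close> \<open>eps < 1\<close>
      by (simp add: output_pmf_def k1_def)
    show "spec q (Block [LoadConst 0 0]) m k1 output_pmf ?R" if "\<not> m 10 < m 1"
      using zero that[unfolded m] by (simp add: output_pmf_def k1_def)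
  qed
  have 2: "spec q (IfLess 4 1 (copy_code q ;; overlap_code q ;;
       IfLess 10 1 (estimate_code q) (Block [LoadConst 0 0])) (Block [LoadConst 0 0]))
     m (k2 + 2) output_pmf ?R" if "relocated m \<and> params m \<and> m 5 = delta" for m
  proof (rule spec_IfLess)
    have m: "m 4 = eps" "m 1 = 1" using that by (auto simp: params_def)
    show "spec q (copy_code q ;; overlap_code q ;;
       IfLess 10 1 (estimate_code q) (Block [LoadConst 0 0])) m k2 output_pmf ?R" if "m 4 < m 1"
    proof -
      have e: "eps < 1" using that[unfolded m] .
      have "spec q (copy_code q ;; overlap_code q ;;
       IfLess 10 1 (estimate_code q) (Block [LoadConst 0 0])) m
         (9 + 6 * (2 * n * q + 3 - (32 + q)) + (11 + n * (7 * q + 7) + (k1 + 2))) output_pmf ?R"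
        by (rule spec_dSeq[OF copy_correct], (use \<open>relocated m \<and> params m \<and> m 5 = delta\<close> in blast)+,
            rule spec_dSeq[OF overlap_correct], blast+, rule 1, assumption, rule e)
      then show ?thesis using e by (simp add: k2_def)
    qed
    show "spec q (Block [LoadConst 0 0]) m k2 output_pmf ?R" if "\<not> m 4 < m 1"
      using zero that[unfolded m] by (simp add: output_pmf_def k2_def)
  qed
  have "spec q (program q) M0 (4 * q + 104 + (5 + (k2 + 2))) output_pmf ?R"
    unfolding program_def
    by (rule spec_dSeq[OF relocate_correct], rule spec_dSeq[OF setup_correct], assumption,
        rule 2, assumption)
  then show ?thesis
    by (rule spec_conseq) (auto simp: runtime_def k2_def k1_def)
qed

section \<open>Accuracy and running time\<close>

lemma ln_le_reps: "ln (2 / delta) \<le> real reps"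
proof -
  have "ln (2 / delta) * ln 2 \<le> ln (2 / delta) * 1"
    using delta ln_2_less_1 by (intro mult_left_mono) auto
  then have "ln (2 / delta) \<le> log 2 (2 / delta)"
    by (simp add: log_def field_simps)
  also have "\<dots> \<le> real reps" unfolding reps_def by linarith
  finally show ?thesis .
qed

lemma reps_pos: "0 < reps"
  using less_reps_iff[of 0] delta by simp

lemma output_correct:
  assumes eps: "0 < eps"
  defines "d \<equiv> dtv_prod q n P Q"
  shows "1 - delta \<le> measure_pmf.prob output_pmf {v. (1 - eps) * d \<le> v \<and> v \<le> (1 + eps) * d}"
proof (cases "eps < 1 \<and> G n < 1")
  case True
  have "0 < bound" using reps_pos n_pos eps by (simp add: bound_def)
  then have "0 < samples" by (simp add: samples_def)
  moreover have "4 * real n * ln (2 / delta) / eps\<^sup>2 \<le> 4 * real n * real reps / eps\<^sup>2"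
    using ln_le_reps eps by (intro divide_right_mono mult_left_mono) auto
  moreover have "4 * real n * real reps / eps\<^sup>2 = bound"
    by (simp add: bound_def power2_eq_square)
  moreover have "bound \<le> real samples" unfolding samples_def by linarith
  ultimately have "1 - delta \<le> measure_pmf.prob (total_pmf samples)
    {s. (1 - eps) * d \<le> (1 - G n) * s / real samples \<and> (1 - G n) * s / real samples \<le> (1 + eps) * d}"
    unfolding d_def using True eps n_pos delta by (intro estimator_concentration) auto
  then show ?thesis using True by (simp add: output_pmf_def vimage_def)
next
  case False
  have "0 \<le> d" using excess_nonneg by (simp add: d_def dtv_eq_excess)
  moreover have "(1 - eps) * d \<le> 0"
  proof (cases "eps < 1")
    case True
    then show ?thesis using False dtv_eq_0 by (simp add: d_def)
  qed (use \<open>0 \<le> d\<close> in \<open>simp add: mult_nonpos_nonneg\<close>)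
  ultimately have "(1 - eps) * d \<le> 0 \<and> 0 \<le> (1 + eps) * d" using eps by simp
  then show ?thesis using False delta by (auto simp: output_pmf_def)
qed

text \<open>For \<open>eps < 1\<close> there are \<open>O(n L / eps^2)\<close> samples of cost
  \<open>O(q n)\<close> each, with \<open>L = 1 + ln (1 / delta)\<close>. This and all other terms
  are absorbed by \<open>V = n^3 L / eps^2\<close> and the constants, since \<open>n\<close> and
  \<open>L\<close> are at least 1.\<close>

lemma runtime_le:
  assumes eps: "0 < eps"
  shows "real runtime \<le> 1000 * (real q + 1) * (1 + real n ^ 3 / eps\<^sup>2 * (1 + ln (1 / delta)))"
proof (cases "eps < 1")
  case False
  have "0 \<le> real n ^ 3 / eps\<^sup>2 * (1 + ln (1 / delta))" using delta by (auto intro!: mult_nonneg_nonneg)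
  then have "1000 * (real q + 1) * 1
      \<le> 1000 * (real q + 1) * (1 + real n ^ 3 / eps\<^sup>2 * (1 + ln (1 / delta)))"
    by (intro mult_left_mono) auto
  moreover have "real runtime \<le> 1000 * (real q + 1) * 1" using False by (simp add: runtime_def)
  ultimately show ?thesis by (rule order_trans[rotated])
next
  case True
  define L where "L = 1 + ln (1 / delta)"
  define Y where "Y = L / eps\<^sup>2"
  define V where "V = real n ^ 3 * Y"
  have L: "1 \<le> L" using delta by (simp add: L_def)
  have n1: "1 \<le> real n" using n_pos by simp
  have e2: "0 < eps\<^sup>2" "eps\<^sup>2 \<le> 1" using eps True by (auto simp: power_le_one)
  have Y: "L \<le> Y" "1 \<le> Y"
    using L e2 mult_left_le[of "eps\<^sup>2" L] by (auto simp: Y_def le_divide_eq)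
  have nn: "real n * real n \<le> real n ^ 3" "real n \<le> real n * real n"
    using n1 by (simp_all add: power3_eq_cube mult_le_cancel_left1)
  have V2: "real n * real n * Y \<le> V"
    using mult_right_mono[OF nn(1), of Y] Y by (simp add: V_def)
  have V1: "real n * Y \<le> V" using mult_right_mono[OF nn(2), of Y] V2 Y by linarith
  have nV: "real n \<le> V" using mult_left_mono[OF Y(2), of "real n"] V1 by simp
  have nY: "1 \<le> real n * Y" using mult_mono[OF n1 Y(2)] by simp
  have LV: "L \<le> V" using mult_right_mono[OF n1, of Y] V1 Y by linarith
  \<comment> \<open>Uses only \<open>ln 2 \<ge> 1/2\<close>; the spare 1 pays for rounding up in
    \<open>reps\<close>.\<close>
  have "log 2 (2 / delta) \<le> 2 * L - 1"
  proof -
    have "log 2 (2 / delta) = 1 + ln (1 / delta) / ln 2"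
      using delta by (simp add: log_def ln_div field_simps)
    also have "ln (1 / delta) / ln 2 \<le> ln (1 / delta) / (1 / 2)"
      using delta ln2_ge_two_thirds by (intro divide_left_mono) auto
    finally show ?thesis by (simp add: L_def)
  qed
  then have reps: "real reps \<le> 2 * L" unfolding reps_def using L by linarith
  have "bound \<le> 2 * L * real n * 4 / eps / eps"
    unfolding bound_def using reps eps by (intro divide_right_mono mult_right_mono) auto
  also have "\<dots> = 8 * (real n * Y)" by (simp add: power2_eq_square Y_def)
  \<comment> \<open>The step from 8 to 9 absorbs the rounding, as \<open>real n * Y\<close> is at
    least 1.\<close>
  finally have samples: "real samples \<le> 9 * (real n * Y)"
    unfolding samples_def using nY by linarith
  then have sV: "real samples \<le> 9 * V" using V1 by linarith
  have snV: "real samples * real n \<le> 9 * V"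
  proof -
    have "real samples * real n \<le> 9 * (real n * Y) * real n"
      using samples by (rule mult_right_mono) simp
    also have "\<dots> = 9 * (real n * real n * Y)" by (simp add: mult_ac)
    finally show ?thesis using V2 by linarith
  qed
  define copied where "copied = 2 * n * q + 3 - (32 + q)"
  have c: "real copied \<le> 2 * (real q * real n) + 3"
  proof -
    have "copied \<le> 2 * n * q + 3" by (simp add: copied_def)
    then have "real copied \<le> real (2 * n * q + 3)" by (rule of_nat_mono)
    then show ?thesis by (simp add: mult_ac)
  qed
  have "real runtime \<le> 6 * real copied + real n * (7 * real q + 7) + 4 * real reps
      + ((real samples * real n) * (10 * real q + 23) + 18 * real samples) + (4 * real q + 160)"
    using True unfolding runtime_def copied_def[symmetric] by (simp add: algebra_simps)
  also have "\<dots> \<le> 6 * (2 * (real q * V) + 3) + V * (7 * real q + 7) + 4 * (2 * V)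
      + ((9 * V) * (10 * real q + 23) + 18 * (9 * V)) + (4 * real q + 160)"
  proof -
    have "real q * real n \<le> real q * V" using nV by (intro mult_left_mono) auto
    then have "6 * (2 * (real q * real n) + 3) \<le> 6 * (2 * (real q * V) + 3)" by simp
    then have "6 * real copied \<le> 6 * (2 * (real q * V) + 3)"
      by (intro order_trans[OF mult_left_mono[OF c]]) auto
    moreover have "4 * real reps \<le> 4 * (2 * V)" "18 * real samples \<le> 18 * (9 * V)"
      using reps LV sV by linarith+
    moreover have "real n * (7 * real q + 7) \<le> V * (7 * real q + 7)"
      using nV by (intro mult_right_mono) auto
    moreover have "(real samples * real n) * (10 * real q + 23) \<le> (9 * V) * (10 * real q + 23)"
      using snV by (intro mult_right_mono) auto
    ultimately show ?thesis by (intro add_mono order_refl)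
  qed
  also have "\<dots> = 109 * (real q * V) + 384 * V + 4 * real q + 178"
    by (simp add: algebra_simps)
  also have "\<dots> \<le> 1000 * (real q * V) + 1000 * V + 1000 * real q + 1000"
    using nV n1 by (intro add_mono mult_right_mono) auto
  also have "\<dots> = 1000 * (real q + 1) * (1 + V)" by (simp add: algebra_simps)
  finally show ?thesis by (simp add: V_def Y_def L_def)
qed

end

text \<open>The time limit exceeds the exact running time, and projecting the coupling shows that
  register 0 has distribution \<open>output_pmf\<close>.\<close>

lemma memory_layout_main:
  assumes "memory_layout q n P Q b delta" "0 < eps"
    and "T = nat \<lceil>1000 * (real q + 1) * (1 + real n ^ 3 / eps\<^sup>2 * (1 + ln (1 / delta)))\<rceil>"
  defines "D \<equiv> run q (compile 0 (program q)) T (0, init_mem q n eps delta P Q)"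
    and "d \<equiv> dtv_prod q n P Q"
  shows "(\<forall>s\<in>set_pmf D. halted (compile 0 (program q)) s) \<and>
    1 - delta \<le> measure_pmf.prob D {s. (1 - eps) * d \<le> snd s 0 \<and> snd s 0 \<le> (1 + eps) * d}"
proof -
  interpret memory_layout q n P Q b eps delta by (rule assms)
  let ?A = "{v. (1 - eps) * d \<le> v \<and> v \<le> (1 + eps) * d}"
  have "runtime \<le> T" using runtime_le assms by (simp add: le_nat_iff) linarith
  from spec_run[OF program_correct this] obtain J where J: "map_pmf fst J = output_pmf"
    "\<forall>s\<in>set_pmf J. snd s 0 = fst s" "D = map_pmf (\<lambda>s. (code_size (program q), snd s)) J"
    unfolding D_def by blast
  have "map_pmf (\<lambda>s. snd s 0) D = map_pmf (\<lambda>s. snd s 0) J"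
    unfolding J(3) by (simp add: map_pmf_comp)
  also have "\<dots> = output_pmf"
    unfolding J(1)[symmetric] using J(2) by (intro map_pmf_cong) auto
  finally have "measure_pmf.prob output_pmf ?A = measure_pmf.prob D ((\<lambda>s. snd s 0) -` ?A)"
    by (metis measure_map_pmf)
  moreover have "1 - delta \<le> measure_pmf.prob output_pmf ?A"
    unfolding d_def by (rule output_correct[OF assms(2)])
  moreover have "halted (compile 0 (program q)) s" if "s \<in> set_pmf D" for s
    using that by (auto simp: J(3) halted_def)
  ultimately show ?thesis by (simp add: vimage_def)
qed

theorem theorem1:
  fixes q :: nat
  assumes "q \<ge> 1"
  shows "\<exists>(prog :: instr list) (C :: real). C > 0 \<and>
    (\<forall>(n :: nat) (P :: nat \<Rightarrow> nat \<Rightarrow> real) (Q :: nat \<Rightarrow> nat \<Rightarrow> real) (eps :: real) (delta :: real).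
       n \<ge> 1 \<longrightarrow> marginals q n P \<longrightarrow> marginals q n Q \<longrightarrow> eps > 0 \<longrightarrow> 0 < delta \<longrightarrow> delta < 1 \<longrightarrow>
       (let T = nat \<lceil>C * (1 + real n ^ 3 / eps\<^sup>2 * (1 + ln (1 / delta)))\<rceil>;
            D = run q prog T (0, init_mem q n eps delta P Q);
            d = dtv_prod q n P Q
        in (\<forall>s\<in>set_pmf D. halted prog s) \<and>
           measure_pmf.prob D {s. (1 - eps) * d \<le> snd s 0 \<and> snd s 0 \<le> (1 + eps) * d}
             \<ge> 1 - delta))"
proof (intro exI conjI allI impI)
  \<comment> \<open>Program and constant depend on \<open>q\<close> alone, the constant
    linearly.\<close>
  show "0 < 1000 * (real q + 1)" by simp
  fix n :: nat and P Q :: "nat \<Rightarrow> nat \<Rightarrow> real" and eps delta :: real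
  assume "n \<ge> 1" "marginals q n P" "marginals q n Q" "eps > 0" "0 < delta" "delta < 1"
  then have layout: "memory_layout q n P Q (2 ^ (2 * q + 40) * n) delta"
    by (simp add: memory_layout_def memory_layout_axioms_def marginal_pair_def)
  show "let T = nat \<lceil>1000 * (real q + 1) * (1 + real n ^ 3 / eps\<^sup>2 * (1 + ln (1 / delta)))\<rceil>;
            D = run q (compile 0 (program q)) T (0, init_mem q n eps delta P Q);
            d = dtv_prod q n P Q
        in (\<forall>s\<in>set_pmf D. halted (compile 0 (program q)) s) \<and>
           measure_pmf.prob D {s. (1 - eps) * d \<le> snd s 0 \<and> snd s 0 \<le> (1 + eps) * d}
             \<ge> 1 - delta"
    unfolding Let_def using memory_layout_main[OF layout \<open>eps > 0\<close> refl] .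
qed

end
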